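(* Let $R$ be a local Cohen-Macaulay ring of dimension $d$, let $I$ be a proper ideal of $R$, and let $a,b\in R$. Then $R(I)_{a,b}$ is Cohen-Macaulay if and only if $I$ is a Cohen-Macaulay $R$-module of dimension $d$. In particular, the Cohen-Macaulayness of $R(I)_{a,b}$ depends only on the ideal $I$.
   Context: All rings are commutative with unity; Cohen-Macaulay local rings are Noetherian. The Rees algebra of $R$ with respect to $I$ is $\mathcal R_+=\bigoplus_{n\ge 0} I^nt^n\subseteq R[t]$, where $t$ is an indeterminate. For $a,b\in R$, let $(I^2(t^2+at+b))$ denote the ideal $(t^2+at+b)R[t]\cap \mathcal R_+$ of $\mathcal R_+$, and set $R(I)_{a,b}=\mathcal R_+/(I^2(t^2+at+b))$. Each element of $R(I)_{a,b}$ is uniquely represented by a polynomial $r+it$ with $r\in R$, $i\in I$.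
   Formalization: The equivalence is stated for a nonzero proper ideal I, since for I = 0 the ring R(I)_{a,b} = R is Cohen-Macaulay while the zero module does not have dimension d; the claim that Cohen-Macaulayness depends only on I is kept for every proper ideal. *)

theory Defs
  imports
    "HOL-Algebra.UnivPoly"
    "HOL-Algebra.QuotRing"
    "HOL-Algebra.Ideal_Product"
    "HOL-Algebra.Ring_Divisibility"
    "HOL-Library.Extended_Nat"
begin

subsection \<open>Local rings and Krull dimension\<close>

locale local_ring = cring +
  assumes unique_maximalideal: "\<exists>!\<mm>. maximalideal \<mm> R"

definition max_ideal :: "('a, 'm) ring_scheme \<Rightarrow> 'a set"
  where "max_ideal R = (THE \<mm>. maximalideal \<mm> R)"

text \<open>The supremum is taken in \<^typ>\<open>enat\<close>, so the zero ring gets dimension 0; below the dimension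
  is only used for nonzero rings.\<close>

definition krull_dim :: "('a, 'm) ring_scheme \<Rightarrow> enat"
  where "krull_dim R = Sup {enat n | n. \<exists>P :: nat \<Rightarrow> 'a set.
    (\<forall>i\<le>n. primeideal (P i) R) \<and> (\<forall>i<n. P i \<subset> P (Suc i))}"


subsection \<open>Modules: dimension, depth, Cohen-Macaulay property\<close>

definition submodule_span ::
    "('a, 'm) ring_scheme \<Rightarrow> ('a, 'c, 'n) module_scheme \<Rightarrow> 'c set \<Rightarrow> 'c set"
  where "submodule_span R M S = \<Inter>{N. submodule N R M \<and> S \<subseteq> N}"

definition finitely_generated_module ::
    "('a, 'm) ring_scheme \<Rightarrow> ('a, 'c, 'n) module_scheme \<Rightarrow> bool"
  where "finitely_generated_module R M \<longleftrightarrow>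
    (\<exists>A \<subseteq> carrier M. finite A \<and> submodule_span R M A = carrier M)"

definition annihilator :: "('a, 'm) ring_scheme \<Rightarrow> ('a, 'c, 'n) module_scheme \<Rightarrow> 'a set"
  where "annihilator R M = {r \<in> carrier R. \<forall>x \<in> carrier M. r \<odot>\<^bsub>M\<^esub> x = \<zero>\<^bsub>M\<^esub>}"

definition module_dim :: "('a, 'm) ring_scheme \<Rightarrow> ('a, 'c, 'n) module_scheme \<Rightarrow> enat"
  where "module_dim R M = krull_dim (R Quot annihilator R M)"

text \<open>The submodule \<open>(S) M\<close> of \<open>M\<close>, where \<open>(S)\<close> is the ideal of \<open>R\<close> generated by \<open>S\<close>.\<close>

definition generated_multiple ::
    "('a, 'm) ring_scheme \<Rightarrow> ('a, 'c, 'n) module_scheme \<Rightarrow> 'a set \<Rightarrow> 'c set"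
  where "generated_multiple R M S = submodule_span R M {s \<odot>\<^bsub>M\<^esub> x | s x. s \<in> S \<and> x \<in> carrier M}"

text \<open>The first condition says that \<open>x\<^sub>i\<close> is a nonzerodivisor on \<open>M / (x\<^sub>0, \<dots>, x\<^sub>i\<^sub>-\<^sub>1) M\<close>, the second
  one that \<open>M / (x\<^sub>0, \<dots>, x\<^sub>n\<^sub>-\<^sub>1) M\<close> is nonzero.\<close>

definition regular_sequence ::
    "('a, 'm) ring_scheme \<Rightarrow> ('a, 'c, 'n) module_scheme \<Rightarrow> 'a list \<Rightarrow> bool"
  where "regular_sequence R M xs \<longleftrightarrow> set xs \<subseteq> carrier R \<and>
    (\<forall>i < length xs. \<forall>y \<in> carrier M.
       xs ! i \<odot>\<^bsub>M\<^esub> y \<in> generated_multiple R M (set (take i xs)) \<longrightarrow>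
       y \<in> generated_multiple R M (set (take i xs))) \<and>
    generated_multiple R M (set xs) \<noteq> carrier M"

definition depth :: "('a, 'm) ring_scheme \<Rightarrow> ('a, 'c, 'n) module_scheme \<Rightarrow> enat"
  where "depth R M = Sup {enat (length xs) | xs. regular_sequence R M xs \<and> set xs \<subseteq> max_ideal R}"

text \<open>Nonzero modules only: the zero module has no dimension in the present sense.\<close>

definition cohen_macaulay_module ::
    "('a, 'm) ring_scheme \<Rightarrow> ('a, 'c, 'n) module_scheme \<Rightarrow> bool"
  where "cohen_macaulay_module R M \<longleftrightarrow>
    local_ring R \<and> noetherian_ring R \<and>
    module R M \<and> finitely_generated_module R M \<and> carrier M \<noteq> {\<zero>\<^bsub>M\<^esub>} \<and>
    depth R M = module_dim R M"

definition self_module :: "('a, 'm) ring_scheme \<Rightarrow> ('a, 'a) module"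
  where "self_module R = \<lparr>carrier = carrier R, monoid.mult = monoid.mult R, one = one R, zero = zero R,
    add = add R, smult = monoid.mult R\<rparr>"

text \<open>The field \<open>one\<close> of this record need not lie in \<open>I\<close>; it plays no role in a module.\<close>

abbreviation ideal_module :: "('a, 'm) ring_scheme \<Rightarrow> 'a set \<Rightarrow> ('a, 'a) module"
  where "ideal_module R I \<equiv> (self_module R)\<lparr>carrier := I\<rparr>"

definition cohen_macaulay_local_ring :: "('a, 'm) ring_scheme \<Rightarrow> bool"
  where "cohen_macaulay_local_ring R \<longleftrightarrow>
    local_ring R \<and> noetherian_ring R \<and> depth R (self_module R) = krull_dim R"


subsection \<open>Quadratic quotients of the Rees algebra\<close>

text \<open>Powers of \<open>I\<close> are taken in the multiplicative monoid of ideals, so \<open>I\<^sup>0\<close> is the whole ring.\<close>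

definition rees_algebra :: "('a, 'm) ring_scheme \<Rightarrow> 'a set \<Rightarrow> ('a, nat \<Rightarrow> 'a) up_ring"
  where "rees_algebra R I = (UP R)\<lparr>carrier :=
    {p \<in> carrier (UP R). \<forall>n::nat. coeff (UP R) p n \<in> I [^]\<^bsub>ideals_set R\<^esub> n}\<rparr>"

definition quadratic_poly :: "('a, 'm) ring_scheme \<Rightarrow> 'a \<Rightarrow> 'a \<Rightarrow> nat \<Rightarrow> 'a"
  where "quadratic_poly R a b =
    monom (UP R) \<one>\<^bsub>R\<^esub> 2 \<oplus>\<^bsub>UP R\<^esub> monom (UP R) a 1 \<oplus>\<^bsub>UP R\<^esub> monom (UP R) b 0"

definition rees_quotient ::
    "('a, 'm) ring_scheme \<Rightarrow> 'a set \<Rightarrow> 'a \<Rightarrow> 'a \<Rightarrow> (nat \<Rightarrow> 'a) set ring"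
  where "rees_quotient R I a b = rees_algebra R I Quot
    (PIdl\<^bsub>UP R\<^esub> (quadratic_poly R a b) \<inter> carrier (rees_algebra R I))"

end

theory Submission
  imports Defs "HOL-Algebra.Subrings"
begin

text \<open>Write \<open>S = R(I)\<^sub>a\<^sub>,\<^sub>b\<close> and let \<open>\<mm>\<close> be the maximal ideal of \<open>R\<close>. Every element of \<open>S\<close> is uniquely
\<open>r + i t\<close> with \<open>r \<in> R\<close>, \<open>i \<in> I\<close>, and \<open>t\<^sup>2 = - a t - b\<close>; so \<open>S\<close> is \<open>R \<oplus> I\<close> as an \<open>R\<close>-module. The element
\<open>r + i t\<close> has the conjugate \<open>(r - a i) - i t\<close>, and the sum and the product of the two lie in \<open>R\<close>. Hence \<open>S\<close> is
integral over \<open>R\<close>, it is local with maximal ideal \<open>\<nn> = \<mm> + I t\<close>, it is Noetherian, and \<open>dim S = dim R = d\<close>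
(\<open>krull_dim_S\<close>). Depth never exceeds dimension (\<open>depth_le_module_dim\<close>), so \<open>S\<close> is Cohen-Macaulay if and only
if there is an \<open>S\<close>-regular sequence of length \<open>d\<close> in \<open>\<nn>\<close>, and \<open>I \<noteq> 0\<close> is Cohen-Macaulay of dimension \<open>d\<close> if and
only if there is an \<open>I\<close>-regular sequence of length \<open>d\<close> in \<open>\<mm>\<close>.

It remains to compare these two conditions. A sequence in \<open>\<mm>\<close> is regular on \<open>S = R \<oplus> I\<close> exactly if it is
regular on both \<open>R\<close> and \<open>I\<close> (\<open>weakly_regular_sum_ideal\<close>). Two points are left: from a regular sequence in \<open>\<nn>\<close>
one has to pass to one of the same length in \<open>\<mm>\<close>, and from separate regular sequences on \<open>R\<close> and on \<open>I\<close>
to a common one. Both follow from one statement about modules over a Noetherian local ring,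
\<open>exists_common_regular_sequence\<close>: if two modules have regular sequences of length \<open>n\<close>, then there is a common
one, and its members can be taken from any prescribed subset of the maximal ideal that is not covered by
finitely many smaller primes. By prime avoidance such a subset is \<open>\<mm>\<close> in \<open>R\<close>, and also the image of \<open>\<mm>\<close> in \<open>S\<close>,
because \<open>\<nn>\<close> is the only prime of \<open>S\<close> that contains this image. The proof of the statement replaces one element
at a time; each step needs that dividing out any regular element lowers the maximal length of a regular
sequence by one only (\<open>regular_length_drop\<close>). That rests on an exchange of socles: if \<open>x\<close> and \<open>y\<close> are regular
on \<open>M\<close>, then \<open>M / x M\<close> has a nonzero element killed by \<open>\<mm>\<close> if and only if \<open>M / y M\<close> has one.

The resulting criterion (\<open>cohen_macaulay_S_iff\<close>) does not mention \<open>a\<close> and \<open>b\<close>, which also gives the last claim;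
it covers \<open>I = 0\<close>, where every sequence of length \<open>d\<close> in \<open>\<mm>\<close> satisfies it.

All modules in the argument have the form \<open>E / K\<close> with ideals \<open>K \<subseteq> E\<close> of one ring, so they are
represented by such pairs: dividing by \<open>x\<close> replaces \<open>K\<close> by \<open>K + x E\<close>, and no quotient module is formed.\<close>

section \<open>Modules as pairs of ideals\<close>

context cring
begin

lemma ideal_closed:
  assumes "ideal K R"
  shows ideal_carrier: "x \<in> K \<Longrightarrow> x \<in> carrier R"
    and ideal_zero: "\<zero> \<in> K"
    and ideal_add: "x \<in> K \<Longrightarrow> y \<in> K \<Longrightarrow> x \<oplus> y \<in> K"
    and ideal_diff: "x \<in> K \<Longrightarrow> y \<in> K \<Longrightarrow> x \<ominus> y \<in> K"
    and ideal_mult: "r \<in> carrier R \<Longrightarrow> x \<in> K \<Longrightarrow> r \<otimes> x \<in> K"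
    and ideal_mult_right: "r \<in> carrier R \<Longrightarrow> x \<in> K \<Longrightarrow> x \<otimes> r \<in> K"
proof -
  interpret ideal K R by fact
  show "x \<in> K \<Longrightarrow> x \<in> carrier R" "\<zero> \<in> K" "x \<in> K \<Longrightarrow> y \<in> K \<Longrightarrow> x \<oplus> y \<in> K"
    "r \<in> carrier R \<Longrightarrow> x \<in> K \<Longrightarrow> r \<otimes> x \<in> K" "r \<in> carrier R \<Longrightarrow> x \<in> K \<Longrightarrow> x \<otimes> r \<in> K"
    by (auto intro: Icarr I_l_closed I_r_closed)
  show "x \<in> K \<Longrightarrow> y \<in> K \<Longrightarrow> x \<ominus> y \<in> K"
    by (simp add: a_minus_def)
qed

lemma idealI_cring:
  assumes "K \<subseteq> carrier R" "\<zero> \<in> K" "\<And>x y. x \<in> K \<Longrightarrow> y \<in> K \<Longrightarrow> x \<oplus> y \<in> K"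
    and mult: "\<And>r x. r \<in> carrier R \<Longrightarrow> x \<in> K \<Longrightarrow> r \<otimes> x \<in> K"
  shows "ideal K R"
proof (rule idealI[OF ring_axioms])
  show "subgroup K (add_monoid R)"
  proof (rule add.subgroupI)
    show "\<ominus> x \<in> K" if "x \<in> K" for x
    proof -
      have "x \<in> carrier R" using that assms(1) by auto
      then have "(\<ominus> \<one>) \<otimes> x = \<ominus> x" by (simp add: l_minus)
      then show ?thesis using mult[of "\<ominus> \<one>" x] that by simp
    qed
  qed (use assms in auto)
  show "x \<otimes> y \<in> K" if "y \<in> carrier R" "x \<in> K" for x y
    using mult[OF that] that assms(1) by (simp add: m_comm subset_iff)
qed (rule mult)

lemma ideal_add_cancel:
  assumes "ideal K R" "x \<in> K" "y \<in> carrier R" "x \<oplus> y \<in> K"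
  shows "y \<in> K"
proof -
  have "(x \<oplus> y) \<ominus> x \<in> K" using ideal_diff[OF assms(1)] assms by blast
  moreover have "x \<in> carrier R" using ideal_carrier assms by blast
  then have "(x \<oplus> y) \<ominus> x = y" using assms(3) by algebra
  ultimately show ?thesis by simp
qed

end

text \<open>\<open>x\<close> is a nonzerodivisor on \<open>E / K\<close>.\<close>

definition regular_mod :: "('a, 'm) ring_scheme \<Rightarrow> 'a set \<Rightarrow> 'a set \<Rightarrow> 'a \<Rightarrow> bool"
  where "regular_mod R E K x \<longleftrightarrow> (\<forall>y\<in>E. x \<otimes>\<^bsub>R\<^esub> y \<in> K \<longrightarrow> y \<in> K)"

text \<open>The ideal \<open>K + x E\<close>, so that \<open>E / (K + x E)\<close> is \<open>E / K\<close> modulo \<open>x\<close>.\<close>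

definition add_multiples :: "('a, 'm) ring_scheme \<Rightarrow> 'a set \<Rightarrow> 'a set \<Rightarrow> 'a \<Rightarrow> 'a set"
  where "add_multiples R E K x = {k \<oplus>\<^bsub>R\<^esub> x \<otimes>\<^bsub>R\<^esub> y | k y. k \<in> K \<and> y \<in> E}"

lemma add_multiplesI:
  "k \<in> K \<Longrightarrow> y \<in> E \<Longrightarrow> u = k \<oplus>\<^bsub>R\<^esub> x \<otimes>\<^bsub>R\<^esub> y \<Longrightarrow> u \<in> add_multiples R E K x"
  unfolding add_multiples_def by blast

text \<open>Successive regularity on \<open>E / K\<close>, where the last quotient may vanish, so that \<open>E = K\<close> is no exception. Over a
local ring and for \<open>E \<noteq> K\<close> Nakayama's lemma makes the last quotient nonzero.\<close>

primrec weakly_regular :: "('a, 'm) ring_scheme \<Rightarrow> 'a set \<Rightarrow> 'a set \<Rightarrow> 'a list \<Rightarrow> bool"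
  where "weakly_regular R E K [] \<longleftrightarrow> True"
  | "weakly_regular R E K (x # xs) \<longleftrightarrow>
       regular_mod R E K x \<and> weakly_regular R E (add_multiples R E K x) xs"

text \<open>If \<open>N\<close> is the maximal ideal of a local ring, this says that the socle of \<open>E / K\<close> is nonzero.\<close>

definition has_socle :: "('a, 'm) ring_scheme \<Rightarrow> 'a set \<Rightarrow> 'a set \<Rightarrow> 'a set \<Rightarrow> bool"
  where "has_socle R N E K \<longleftrightarrow> (\<exists>e\<in>E. e \<notin> K \<and> (\<forall>r\<in>N. r \<otimes>\<^bsub>R\<^esub> e \<in> K))"

context cring
begin

context
  fixes E K :: "'a set"
  assumes E: "ideal E R" and K: "ideal K R"
begin

lemma add_multiples_ideal:
  assumes [simp]: "x \<in> carrier R"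
  shows "ideal (add_multiples R E K x) R"
proof (rule idealI_cring)
  note carr = ideal_carrier[OF E] ideal_carrier[OF K]
  show "add_multiples R E K x \<subseteq> carrier R" using carr by (auto simp: add_multiples_def)
  show "\<zero> \<in> add_multiples R E K x"
    by (rule add_multiplesI[OF ideal_zero[OF K] ideal_zero[OF E]]) simp
  fix u assume "u \<in> add_multiples R E K x"
  then obtain k y where u: "u = k \<oplus> x \<otimes> y" and ky: "k \<in> K" "y \<in> E" by (auto simp: add_multiples_def)
  then have c: "k \<in> carrier R" "y \<in> carrier R" using carr by auto
  {
    fix v assume "v \<in> add_multiples R E K x"
    then obtain l z where v: "v = l \<oplus> x \<otimes> z" and lz: "l \<in> K" "z \<in> E" by (auto simp: add_multiples_def)
    then have "l \<in> carrier R" "z \<in> carrier R" using carr by auto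
    with c have "u \<oplus> v = (k \<oplus> l) \<oplus> x \<otimes> (y \<oplus> z)" unfolding u v using assms by algebra
    then show "u \<oplus> v \<in> add_multiples R E K x"
      using ideal_add[OF E] ideal_add[OF K] ky lz by (intro add_multiplesI) auto
  }
  fix r assume r: "r \<in> carrier R"
  with c have "r \<otimes> u = r \<otimes> k \<oplus> x \<otimes> (r \<otimes> y)" unfolding u using assms by algebra
  then show "r \<otimes> u \<in> add_multiples R E K x"
    using ideal_mult[OF E r] ideal_mult[OF K r] ky by (intro add_multiplesI) auto
qed

lemma subset_add_multiples:
  assumes "x \<in> carrier R"
  shows "K \<subseteq> add_multiples R E K x"
proof
  fix k assume k: "k \<in> K"
  then have "k = k \<oplus> x \<otimes> \<zero>" using ideal_carrier[OF K] assms by auto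
  with k show "k \<in> add_multiples R E K x" using ideal_zero[OF E] by (intro add_multiplesI)
qed

lemma multiple_in_add_multiples:
  assumes "x \<in> carrier R" "y \<in> E"
  shows "x \<otimes> y \<in> add_multiples R E K x"
proof -
  have "x \<otimes> y = \<zero> \<oplus> x \<otimes> y" using ideal_carrier[OF E] assms by auto
  then show ?thesis using ideal_zero[OF K] assms by (intro add_multiplesI)
qed

lemma add_multiples_subset:
  assumes "x \<in> carrier R" "K \<subseteq> E"
  shows "add_multiples R E K x \<subseteq> E"
  using ideal_add[OF E] ideal_mult[OF E] assms by (auto simp: add_multiples_def)

lemma add_multiples_commute:
  assumes [simp]: "x \<in> carrier R" "y \<in> carrier R"
  shows "add_multiples R E (add_multiples R E K x) y = add_multiples R E (add_multiples R E K y) x"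
proof -
  have *: "add_multiples R E (add_multiples R E K x) y \<subseteq> add_multiples R E (add_multiples R E K y) x"
    if xy: "x \<in> carrier R" "y \<in> carrier R" for x y
  proof
    fix u assume "u \<in> add_multiples R E (add_multiples R E K x) y"
    then obtain k e f where u: "u = (k \<oplus> x \<otimes> e) \<oplus> y \<otimes> f" and kef: "k \<in> K" "e \<in> E" "f \<in> E"
      by (auto simp: add_multiples_def)
    then have "k \<in> carrier R" "e \<in> carrier R" "f \<in> carrier R"
      using ideal_carrier[OF E] ideal_carrier[OF K] by auto
    with xy have "u = (k \<oplus> y \<otimes> f) \<oplus> x \<otimes> e"
      unfolding u by algebra
    then show "u \<in> add_multiples R E (add_multiples R E K y) x"
      unfolding add_multiples_def using kef by blast
  qed
  show ?thesis using *[of x y] *[of y x] by auto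
qed

text \<open>Let \<open>e\<close> represent a socle element of \<open>E / (K + x E)\<close>. Since \<open>y e\<close> lies in \<open>K + x E\<close>, it is \<open>x f\<close> modulo \<open>K\<close>
for some \<open>f\<close>. This \<open>f\<close> represents a socle element of \<open>E / (K + y E)\<close>: the relation \<open>y e = x f\<close> is symmetric, and
multiples of \<open>x\<close> and \<open>y\<close> can be cancelled modulo \<open>K\<close>.\<close>

lemma socle_exchange:
  assumes N: "N \<subseteq> carrier R" and x: "x \<in> carrier R" and yN: "y \<in> N"
    and regx: "regular_mod R E K x" and regy: "regular_mod R E K y"
    and socle: "has_socle R N E (add_multiples R E K x)"
  shows "has_socle R N E (add_multiples R E K y)"
proof -
  note carr = ideal_carrier[OF E] ideal_carrier[OF K]
  obtain e where e: "e \<in> E" "e \<notin> add_multiples R E K x" "\<And>r. r \<in> N \<Longrightarrow> r \<otimes> e \<in> add_multiples R E K x"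
    using socle by (auto simp: has_socle_def)
  obtain k f where kf: "k \<in> K" "f \<in> E" and ye: "y \<otimes> e = k \<oplus> x \<otimes> f"
    using e(3)[OF yN] by (auto simp: add_multiples_def)
  have c: "y \<in> carrier R" "e \<in> carrier R" "k \<in> carrier R" "f \<in> carrier R"
    using yN N e(1) kf carr by auto
  have "f \<notin> add_multiples R E K y"
  proof
    assume "f \<in> add_multiples R E K y"
    then obtain l g where lg: "l \<in> K" "g \<in> E" and f: "f = l \<oplus> y \<otimes> g" by (auto simp: add_multiples_def)
    have d: "l \<in> carrier R" "g \<in> carrier R" using lg carr by auto
    have "y \<otimes> (e \<ominus> x \<otimes> g) = y \<otimes> e \<ominus> x \<otimes> (y \<otimes> g)"
      using c x d by algebra
    also have "\<dots> = k \<oplus> x \<otimes> l"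
      unfolding ye f using c x d by algebra
    finally have "y \<otimes> (e \<ominus> x \<otimes> g) \<in> K" using kf lg ideal_add[OF K] ideal_mult[OF K] x by simp
    then have "e \<ominus> x \<otimes> g \<in> K" using regy e(1) lg ideal_diff[OF E] ideal_mult[OF E x]
      by (simp add: regular_mod_def)
    moreover have "e = (e \<ominus> x \<otimes> g) \<oplus> x \<otimes> g" using c x d by algebra
    ultimately show False using e(2) lg unfolding add_multiples_def by blast
  qed
  moreover have "r \<otimes> f \<in> add_multiples R E K y" if r: "r \<in> N" for r
  proof -
    obtain l g where lg: "l \<in> K" "g \<in> E" and re: "r \<otimes> e = l \<oplus> x \<otimes> g"
      using e(3)[OF r] by (auto simp: add_multiples_def)
    have d: "l \<in> carrier R" "g \<in> carrier R" "r \<in> carrier R" using lg carr r N by auto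
    have "x \<otimes> (r \<otimes> f \<ominus> y \<otimes> g) = (r \<otimes> (k \<oplus> x \<otimes> f) \<ominus> r \<otimes> k) \<ominus> (y \<otimes> (l \<oplus> x \<otimes> g) \<ominus> y \<otimes> l)"
      using c x d by algebra
    also have "\<dots> = y \<otimes> l \<ominus> r \<otimes> k"
      unfolding ye[symmetric] re[symmetric] using c x d by algebra
    finally have "x \<otimes> (r \<otimes> f \<ominus> y \<otimes> g) \<in> K"
      using kf lg ideal_diff[OF K] ideal_mult[OF K] c d by simp
    then have "r \<otimes> f \<ominus> y \<otimes> g \<in> K" using regx kf lg ideal_diff[OF E] ideal_mult[OF E] c d
      by (simp add: regular_mod_def)
    moreover have "r \<otimes> f = (r \<otimes> f \<ominus> y \<otimes> g) \<oplus> y \<otimes> g" using c x d by algebra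
    ultimately show ?thesis using lg unfolding add_multiples_def by blast
  qed
  ultimately show ?thesis using kf by (auto simp: has_socle_def)
qed

text \<open>The part of permuting a regular sequence \<open>x, w\<close> that holds over every ring: if \<open>x y\<close> is a multiple of \<open>w\<close>
modulo \<open>K\<close>, then the cofactor is a multiple of \<open>x\<close>, which can be cancelled.\<close>

lemma regular_mod_swap:
  assumes x: "x \<in> carrier R" and w: "w \<in> carrier R"
    and regx: "regular_mod R E K x" and regw: "regular_mod R E (add_multiples R E K x) w"
  shows "regular_mod R E (add_multiples R E K w) x"
  unfolding regular_mod_def
proof (intro ballI impI)
  note carr = ideal_carrier[OF E] ideal_carrier[OF K]
  fix y assume y: "y \<in> E" "x \<otimes> y \<in> add_multiples R E K w"
  then obtain k z where kz: "k \<in> K" "z \<in> E" and xy: "x \<otimes> y = k \<oplus> w \<otimes> z" by (auto simp: add_multiples_def)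
  have c: "k \<in> carrier R" "z \<in> carrier R" "y \<in> carrier R" using y kz carr by auto
  have "w \<otimes> z = (k \<oplus> w \<otimes> z) \<ominus> k" using c w by algebra
  also have "\<dots> \<in> add_multiples R E K x"
    using multiple_in_add_multiples[OF x y(1)] subset_add_multiples[OF x] kz
      ideal_diff[OF add_multiples_ideal[OF x]] unfolding xy by blast
  finally have "z \<in> add_multiples R E K x" using regw kz by (simp add: regular_mod_def)
  then obtain l z' where lz: "l \<in> K" "z' \<in> E" and z: "z = l \<oplus> x \<otimes> z'" by (auto simp: add_multiples_def)
  have d: "l \<in> carrier R" "z' \<in> carrier R" using lz carr by auto
  have "x \<otimes> (y \<ominus> w \<otimes> z') = (x \<otimes> y) \<ominus> x \<otimes> (w \<otimes> z')"
    using c x w d by algebra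
  also have "\<dots> = k \<oplus> w \<otimes> l" unfolding xy z using c x w d by algebra
  finally have "x \<otimes> (y \<ominus> w \<otimes> z') \<in> K" using kz lz ideal_add[OF K] ideal_mult[OF K w] by simp
  then have "y \<ominus> w \<otimes> z' \<in> K" using regx y lz ideal_diff[OF E] ideal_mult[OF E w]
    by (simp add: regular_mod_def)
  moreover have "y = (y \<ominus> w \<otimes> z') \<oplus> w \<otimes> z'" using c x w d by algebra
  ultimately show "y \<in> add_multiples R E K w" using lz unfolding add_multiples_def by blast
qed

lemma regular_mod_no_socle:
  assumes "r \<in> N" "regular_mod R E K r"
  shows "\<not> has_socle R N E K"
  using assms by (auto simp: has_socle_def regular_mod_def)

lemma ideal_colon:
  assumes "u \<in> carrier R"
  shows "ideal {r \<in> carrier R. r \<otimes> u \<in> K} R"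
proof (rule idealI_cring)
  show "\<zero> \<in> {r \<in> carrier R. r \<otimes> u \<in> K}" using assms ideal_zero[OF K] by simp
  show "x \<oplus> y \<in> {r \<in> carrier R. r \<otimes> u \<in> K}"
    if "x \<in> {r \<in> carrier R. r \<otimes> u \<in> K}" "y \<in> {r \<in> carrier R. r \<otimes> u \<in> K}" for x y
    using that assms ideal_add[OF K] by (auto simp: l_distr)
  show "r \<otimes> x \<in> {r \<in> carrier R. r \<otimes> u \<in> K}"
    if "r \<in> carrier R" "x \<in> {r \<in> carrier R. r \<otimes> u \<in> K}" for r x
    using that assms ideal_mult[OF K] by (auto simp: m_assoc)
qed auto

end

end

section \<open>Noetherian rings: prime avoidance and associated primes\<close>

context cring
begin

text \<open>A prime ideal that contains an intersection of finitely many ideals contains one of them: otherwise the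
product of elements outside \<open>P\<close>, one from each ideal, would lie in \<open>P\<close>.\<close>

lemma exists_Inter_outside_prime:
  assumes "finite F" "\<And>Q. Q \<in> F \<Longrightarrow> ideal Q R" "primeideal P R" "\<And>Q. Q \<in> F \<Longrightarrow> \<not> Q \<subseteq> P"
  shows "\<exists>r\<in>carrier R. r \<notin> P \<and> (\<forall>Q\<in>F. r \<in> Q)"
proof -
  interpret P: primeideal P R by fact
  show ?thesis using assms(1,2,4)
  proof (induction F)
    case empty
    then show ?case using P.I_notcarr ideal_carrier[OF P.is_ideal] by auto
  next
    case (insert Q H)
    then obtain r where r: "r \<in> carrier R" "r \<notin> P" "\<forall>Q\<in>H. r \<in> Q" by auto
    obtain s where s: "s \<in> Q" "s \<notin> P" using insert.prems(2) by blast
    have sc: "s \<in> carrier R" using ideal_carrier[OF insert.prems(1)[OF insertI1] s(1)] .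
    have "r \<otimes> s \<notin> P" using P.I_prime r s sc by blast
    moreover have "r \<otimes> s \<in> Q'" if "Q' \<in> insert Q H" for Q'
    proof -
      have "ideal Q' R" using that insert.prems(1) by blast
      then show ?thesis
        using that ideal_mult[of Q' r s] ideal_mult_right[of Q' s r] r s(1) sc by auto
    qed
    ultimately show ?case using r sc by blast
  qed
qed

text \<open>By induction the primes may be assumed incomparable, since a prime inside another one can be dropped. If
\<open>x\<close> avoids all primes but \<open>P\<close>, and \<open>y \<in> J\<close> lies in all primes but \<open>P\<close>, then \<open>x\<close> or \<open>x + y\<close> avoids all of them.\<close>

lemma prime_avoidance:
  assumes "finite F" "\<And>P. P \<in> F \<Longrightarrow> primeideal P R" "ideal J R" "\<And>P. P \<in> F \<Longrightarrow> \<not> J \<subseteq> P"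
  shows "\<exists>z\<in>J. \<forall>P\<in>F. z \<notin> P"
  using assms(1,2,4)
proof (induction F rule: finite_psubset_induct)
  case (psubset F)
  have IH: "\<exists>z\<in>J. \<forall>P\<in>F - {Q}. z \<notin> P" if "Q \<in> F" for Q
    using psubset.IH[of "F - {Q}"] psubset.prems that by auto
  consider "F = {}" | P Q where "P \<in> F" "Q \<in> F" "Q \<noteq> P" "Q \<subseteq> P"
    | P where "P \<in> F" "\<And>Q. Q \<in> F - {P} \<Longrightarrow> \<not> Q \<subseteq> P" by blast
  then show ?case
  proof cases
    case 1
    then show ?thesis using ideal_zero assms(3) by auto
  next
    case 2
    then show ?thesis using IH[of Q] by blast
  next
    case 3
    interpret P: primeideal P R using psubset.prems 3 by blast
    obtain x where x: "x \<in> J" "\<forall>Q\<in>F - {P}. x \<notin> Q" using IH 3 by blast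
    have ids: "\<And>Q. Q \<in> insert J (F - {P}) \<Longrightarrow> ideal Q R"
      using psubset.prems(1) assms(3) primeideal_def by blast
    have nsub: "\<And>Q. Q \<in> insert J (F - {P}) \<Longrightarrow> \<not> Q \<subseteq> P"
      using psubset.prems(2) 3 by blast
    show ?thesis
    proof (cases "x \<in> P")
      case True
      obtain y where y: "y \<in> carrier R" "y \<notin> P" "y \<in> J" "\<forall>Q\<in>F - {P}. y \<in> Q"
        using exists_Inter_outside_prime[of "insert J (F - {P})" P, OF _ ids P.primeideal nsub] psubset.hyps
        by blast
      have xc: "x \<in> carrier R" using ideal_carrier assms(3) x by blast
      have "y \<oplus> x \<notin> Q" if Q: "Q \<in> F - {P}" for Q
        using ideal_add_cancel[of Q y x] ids y xc x Q by blast
      moreover have "x \<oplus> y \<notin> P"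
        using ideal_add_cancel[OF P.is_ideal True y(1)] y(2) by blast
      moreover have "x \<oplus> y \<in> J" using ideal_add[OF assms(3)] x y by blast
      moreover have "y \<oplus> x = x \<oplus> y" using a_comm xc y(1) by blast
      ultimately show ?thesis by (intro bexI[of _ "x \<oplus> y"]) auto
    qed (use x in blast)
  qed
qed

end

locale noetherian_cring = cring + noetherian_ring

context noetherian_cring
begin

lemma exists_maximal_member:
  assumes "\<C> \<noteq> {}" and "\<And>J. J \<in> \<C> \<Longrightarrow> ideal J R"
  obtains M where "M \<in> \<C>" "\<And>J. J \<in> \<C> \<Longrightarrow> M \<subseteq> J \<Longrightarrow> J = M"
proof -
  have "\<exists>M\<in>\<C>. \<forall>J\<in>\<C>. M \<subseteq> J \<longrightarrow> J = M"
  proof (rule subset_Zorn)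
    fix C assume C: "subset.chain \<C> C"
    show "\<exists>U\<in>\<C>. \<forall>J\<in>C. J \<subseteq> U"
    proof (cases "C = {}")
      case True
      then show ?thesis using assms(1) by auto
    next
      case False
      have "subset.chain {J. ideal J R} C" using C assms(2) unfolding pred_on.chain_def by auto
      with False have "\<Union>C \<in> C" by (rule ideal_chain_is_trivial)
      then show ?thesis using C unfolding pred_on.chain_def by auto
    qed
  qed
  then show ?thesis using that by blast
qed

text \<open>An ideal that is maximal among the ideals containing \<open>J\<close> and disjoint from a multiplicative set is prime.\<close>

lemma exists_prime_disjoint:
  assumes J: "ideal J R" and T: "\<one> \<in> T" "\<And>s t. s \<in> T \<Longrightarrow> t \<in> T \<Longrightarrow> s \<otimes> t \<in> T"
    and disj: "J \<inter> T = {}"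
  obtains P where "primeideal P R" "J \<subseteq> P" "P \<inter> T = {}"
proof -
  obtain P where P: "P \<in> {P. ideal P R \<and> J \<subseteq> P \<and> P \<inter> T = {}}"
    and max: "\<And>Q. Q \<in> {P. ideal P R \<and> J \<subseteq> P \<and> P \<inter> T = {}} \<Longrightarrow> P \<subseteq> Q \<Longrightarrow> Q = P"
    by (rule exists_maximal_member[of "{P. ideal P R \<and> J \<subseteq> P \<and> P \<inter> T = {}}"]) (use assms in auto)
  have idP: "ideal P R" using P by simp
  have meet: "\<exists>p\<in>P. \<exists>y\<in>carrier R. p \<oplus> a \<otimes> y \<in> T" if a: "a \<in> carrier R" "a \<notin> P" for a
  proof (rule ccontr)
    assume "\<not> ?thesis"
    then have "add_multiples R (carrier R) P a \<inter> T = {}" by (auto simp: add_multiples_def)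
    moreover have "P \<subseteq> add_multiples R (carrier R) P a"
      using subset_add_multiples[OF oneideal idP a(1)] .
    ultimately have "add_multiples R (carrier R) P a = P"
      using max[of "add_multiples R (carrier R) P a"] add_multiples_ideal[OF oneideal idP a(1)] P
      by blast
    moreover have "a \<in> add_multiples R (carrier R) P a"
      using multiple_in_add_multiples[OF oneideal idP a(1) one_closed] a by simp
    ultimately show False using a by simp
  qed
  have "primeideal P R"
  proof (rule primeidealI[OF idP is_cring])
    show "carrier R \<noteq> P" using P T(1) one_closed by auto
    fix a b assume a: "a \<in> carrier R" and b: "b \<in> carrier R" and ab: "a \<otimes> b \<in> P"
    show "a \<in> P \<or> b \<in> P"
    proof (rule ccontr)
      assume "\<not> ?thesis"
      with a b meet obtain p y q z where p: "p \<in> P" "y \<in> carrier R" "p \<oplus> a \<otimes> y \<in> T"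
        and q: "q \<in> P" "z \<in> carrier R" "q \<oplus> b \<otimes> z \<in> T" by metis
      have c: "p \<in> carrier R" "q \<in> carrier R" "y \<in> carrier R" "z \<in> carrier R"
        using p q ideal_carrier[OF idP] by auto
      have "(p \<oplus> a \<otimes> y) \<otimes> (q \<oplus> b \<otimes> z) = (q \<oplus> b \<otimes> z) \<otimes> p \<oplus> ((a \<otimes> y) \<otimes> q \<oplus> (y \<otimes> z) \<otimes> (a \<otimes> b))"
        using a b c by algebra
      also have "\<dots> \<in> P" using a b c p(1) q(1) ab
        by (intro ideal_add[OF idP] ideal_mult[OF idP _ p(1)] ideal_mult[OF idP _ q(1)]
          ideal_mult[OF idP _ ab]) auto
      finally show False using T(2)[OF p(3) q(3)] P by auto
    qed
  qed
  then show ?thesis using that P by auto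
qed

text \<open>The primes are the maximal members of the family of annihilators \<open>K : u\<close> of elements \<open>u\<close> of \<open>E\<close> outside
\<open>K\<close>. They are finitely many: choose a finite set \<open>G\<close> of them whose elements \<open>u\<close> span a largest possible ideal.
The element \<open>u\<close> that belongs to any further \<open>P\<close> lies in this span, so it is killed by \<open>\<Inter>G\<close>. Hence \<open>P\<close> contains
\<open>\<Inter>G\<close> and therefore a member of \<open>G\<close>, with which it coincides by maximality.\<close>

lemma finite_associated_primes:
  assumes E: "ideal E R" and K: "ideal K R"
  obtains F where "finite F" "\<And>P. P \<in> F \<Longrightarrow> primeideal P R"
    "\<And>P. P \<in> F \<Longrightarrow> \<exists>u\<in>E. u \<notin> K \<and> P = {r \<in> carrier R. r \<otimes> u \<in> K}"
    "\<And>x. x \<in> carrier R \<Longrightarrow> \<not> regular_mod R E K x \<Longrightarrow> \<exists>P\<in>F. x \<in> P"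
proof -
  note carr = ideal_carrier[OF E] ideal_carrier[OF K]
  define colon where "colon u = {r \<in> carrier R. r \<otimes> u \<in> K}" for u
  have colon: "ideal (colon u) R" if "u \<in> E" for u
    unfolding colon_def using ideal_colon[OF E K] carr that by auto
  define F where "F = {colon u | u. u \<in> E - K \<and> (\<forall>v\<in>E - K. colon u \<subseteq> colon v \<longrightarrow> colon v = colon u)}"
  obtain rep where rep: "\<And>P. P \<in> F \<Longrightarrow> rep P \<in> E - K \<and> P = colon (rep P)"
    using bchoice[of F "\<lambda>P u. u \<in> E - K \<and> P = colon u"] by (auto simp: F_def)
  have max: "Q = P" if "P \<in> F" "Q \<in> F" "P \<subseteq> Q" for P Q
    using that by (auto simp: F_def)
  have prime: "primeideal P R" if P: "P \<in> F" for P
  proof (rule primeidealI[OF _ is_cring])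
    obtain u where u: "u \<in> E" "u \<notin> K" "P = colon u"
      "\<And>v. v \<in> E - K \<Longrightarrow> colon u \<subseteq> colon v \<Longrightarrow> colon v = colon u" using P by (auto simp: F_def)
    show "ideal P R" using colon u by simp
    have "\<one> \<notin> P" using u carr by (auto simp: colon_def)
    then show "carrier R \<noteq> P" using one_closed by auto
    fix a b assume a: "a \<in> carrier R" and b: "b \<in> carrier R" and ab: "a \<otimes> b \<in> P"
    show "a \<in> P \<or> b \<in> P"
    proof (cases "b \<in> P")
      case False
      with b u have bu: "b \<otimes> u \<in> E - K" using ideal_mult[OF E] by (auto simp: colon_def)
      have "colon u \<subseteq> colon (b \<otimes> u)"
      proof
        fix r assume r: "r \<in> colon u"
        have c: "r \<in> carrier R" "u \<in> carrier R" using r u carr by (auto simp: colon_def)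
        have "r \<otimes> (b \<otimes> u) = b \<otimes> (r \<otimes> u)" using c b by (simp add: m_lcomm)
        then show "r \<in> colon (b \<otimes> u)" using r ideal_mult[OF K b] by (auto simp: colon_def)
      qed
      then have "colon (b \<otimes> u) = colon u" using u(4) bu by blast
      moreover have "a \<in> colon (b \<otimes> u)"
        using ab u a b carr by (auto simp: colon_def m_assoc)
      ultimately show ?thesis using u by simp
    qed simp
  qed
  have zd: "\<exists>P\<in>F. x \<in> P" if x: "x \<in> carrier R" "\<not> regular_mod R E K x" for x
  proof -
    obtain y where y: "y \<in> E" "x \<otimes> y \<in> K" "y \<notin> K" using x by (auto simp: regular_mod_def)
    obtain M where M: "M \<in> {colon v | v. v \<in> E - K \<and> colon y \<subseteq> colon v}"
      and Mmax: "\<And>J. J \<in> {colon v | v. v \<in> E - K \<and> colon y \<subseteq> colon v} \<Longrightarrow> M \<subseteq> J \<Longrightarrow> J = M"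
      by (rule exists_maximal_member[of "{colon v | v. v \<in> E - K \<and> colon y \<subseteq> colon v}"])
        (use y colon in auto)
    then obtain v where v: "v \<in> E - K" "colon y \<subseteq> colon v" "M = colon v" by blast
    have "colon w = colon v" if "w \<in> E - K" "colon v \<subseteq> colon w" for w
      using Mmax[of "colon w"] that v by auto
    then have "M \<in> F" unfolding F_def mem_Collect_eq using v(1,3) by blast
    moreover have "x \<in> M" using x y v by (auto simp: colon_def)
    ultimately show ?thesis by blast
  qed
  have "finite F"
  proof -
    define \<C> where "\<C> = {Idl (rep ` G) | G. finite G \<and> G \<subseteq> F}"
    have repc: "rep ` G \<subseteq> carrier R" if "G \<subseteq> F" for G using rep that carr by blast
    obtain M where M: "M \<in> \<C>" and Mmax: "\<And>J. J \<in> \<C> \<Longrightarrow> M \<subseteq> J \<Longrightarrow> J = M"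
      by (rule exists_maximal_member[of \<C>]) (use repc genideal_ideal in \<open>auto simp: \<C>_def\<close>)
    then obtain G where G: "finite G" "G \<subseteq> F" "M = Idl (rep ` G)" by (auto simp: \<C>_def)
    have "F \<subseteq> G"
    proof
      fix P assume P: "P \<in> F"
      have insc: "rep ` insert P G \<subseteq> carrier R" using repc[of "insert P G"] P G by auto
      have "M \<subseteq> Idl (rep ` insert P G)"
        unfolding G(3) by (rule subset_Idl_subset[OF insc]) auto
      moreover have "Idl (rep ` insert P G) \<in> \<C>"
        unfolding \<C>_def using P G by blast
      ultimately have eq: "Idl (rep ` insert P G) = M" using Mmax by blast
      have "rep P \<in> rep ` insert P G" by simp
      then have repM: "rep P \<in> M" using genideal_self[OF insc] eq by blast
      show "P \<in> G"
      proof (rule ccontr)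
        assume nG: "P \<notin> G"
        have "\<exists>r\<in>carrier R. r \<notin> P \<and> (\<forall>Q\<in>G. r \<in> Q)"
        proof (rule exists_Inter_outside_prime[OF G(1) _ prime[OF P]])
          fix Q assume Q: "Q \<in> G"
          then show "ideal Q R" using prime G(2) primeideal_def by blast
          show "\<not> Q \<subseteq> P" using max[of Q P] G(2) Q P nG by blast
        qed
        then obtain r where r: "r \<in> carrier R" "r \<notin> P" "\<forall>Q\<in>G. r \<in> Q" using G by blast
        have "r \<otimes> rep Q \<in> K" if "Q \<in> G" for Q using rep[of Q] r that G by (auto simp: colon_def)
        then have "rep ` G \<subseteq> {v \<in> carrier R. v \<otimes> r \<in> K}" 
          using repc[OF G(2)] r(1) m_comm by (auto simp: subset_iff)
        then have "M \<subseteq> {v \<in> carrier R. v \<otimes> r \<in> K}"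
          unfolding G(3) by (rule genideal_minimal[OF ideal_colon[OF E K r(1)]])
        then have "rep P \<otimes> r \<in> K" using repM by auto
        then have "r \<in> colon (rep P)" using rep[OF P] r(1) carr m_comm[of "rep P" r]
          unfolding colon_def by auto
        then show False using rep[OF P] r(2) by blast
      qed
    qed
    then show ?thesis using G finite_subset by blast
  qed
  then show ?thesis
  proof (rule that[OF _ prime _ zd])
    show "\<exists>u\<in>E. u \<notin> K \<and> P = {r \<in> carrier R. r \<otimes> u \<in> K}" if "P \<in> F" for P
      using rep[OF that] unfolding colon_def by blast
  qed
qed

end

section \<open>Regular sequences over Noetherian local rings\<close>

text \<open>What a set must satisfy for prime avoidance to pick its elements outside any finite set of primes
other than \<open>\<mm>\<close>.\<close>

definition generic_set :: "('a, 'm) ring_scheme \<Rightarrow> 'a set \<Rightarrow> 'a set \<Rightarrow> bool"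
  where "generic_set R \<mm> B \<longleftrightarrow> B \<subseteq> \<mm> \<and>
    (\<forall>F. finite F \<longrightarrow> (\<forall>P\<in>F. primeideal P R \<and> P \<noteq> \<mm>) \<longrightarrow> (\<exists>z\<in>B. \<forall>P\<in>F. z \<notin> P))"

text \<open>The maximal ideal is a parameter characterized by units, which is how locality is used and how it is
verified for quadratic extensions.\<close>

locale noetherian_local = noetherian_cring +
  fixes \<mm> :: "'a set"
  assumes \<mm>_ideal: "ideal \<mm> R" and one_notin: "\<one> \<notin> \<mm>"
    and unit_outside: "x \<in> carrier R \<Longrightarrow> x \<notin> \<mm> \<Longrightarrow> x \<in> Units R"
begin

lemma \<mm>_carrier: "x \<in> \<mm> \<Longrightarrow> x \<in> carrier R"
  by (rule ideal_carrier[OF \<mm>_ideal])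

lemma proper_ideal_subset:
  assumes "ideal J R" "\<one> \<notin> J"
  shows "J \<subseteq> \<mm>"
proof
  fix x assume x: "x \<in> J"
  show "x \<in> \<mm>"
  proof (rule ccontr)
    assume "x \<notin> \<mm>"
    then have "x \<in> Units R" using unit_outside ideal_carrier[OF assms(1) x] by blast
    then have "inv x \<otimes> x \<in> J" "inv x \<otimes> x = \<one>"
      using ideal_mult[OF assms(1) Units_inv_closed[of x] x] Units_l_inv[of x] by blast+
    then show False using assms(2) by simp
  qed
qed

text \<open>\<open>1 - c x\<close> is a unit.\<close>

lemma cancel_one_minus:
  assumes K: "ideal K R" and x: "x \<in> \<mm>" and c: "c \<in> carrier R" and y: "y \<in> carrier R"
    and "(\<one> \<ominus> c \<otimes> x) \<otimes> y \<in> K"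
  shows "y \<in> K"
proof -
  have xc: "x \<in> carrier R" using \<mm>_carrier x .
  have "\<one> \<ominus> c \<otimes> x \<notin> \<mm>"
  proof
    assume "\<one> \<ominus> c \<otimes> x \<in> \<mm>"
    then have "(\<one> \<ominus> c \<otimes> x) \<oplus> c \<otimes> x \<in> \<mm>"
      using ideal_add[OF \<mm>_ideal] ideal_mult[OF \<mm>_ideal c x] by blast
    moreover have "(\<one> \<ominus> c \<otimes> x) \<oplus> c \<otimes> x = \<one>"
      using c xc by algebra
    ultimately show False using one_notin by simp
  qed
  then have u: "\<one> \<ominus> c \<otimes> x \<in> Units R" using unit_outside c xc by simp
  have "inv (\<one> \<ominus> c \<otimes> x) \<otimes> ((\<one> \<ominus> c \<otimes> x) \<otimes> y) \<in> K"
    using ideal_mult[OF K Units_inv_closed[OF u] assms(5)] .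
  also have "inv (\<one> \<ominus> c \<otimes> x) \<otimes> ((\<one> \<ominus> c \<otimes> x) \<otimes> y) = y"
    using m_assoc[OF Units_inv_closed[OF u] Units_closed[OF u] y] Units_l_inv[OF u] y by simp
  finally show ?thesis .
qed

text \<open>Nakayama's lemma for \<open>(U + K) / K\<close>. Instead of generators it uses a largest ideal of the form \<open>K + (y)\<close> with
\<open>y \<in> U\<close> outside \<open>K\<close>: writing \<open>y = k + x y'\<close>, one has \<open>K + (y) \<subseteq> K + (y')\<close>, hence equality, so \<open>y'\<close> is a multiple
of \<open>x y'\<close> modulo \<open>K\<close> and lies in \<open>K\<close>, a contradiction.\<close>

lemma nakayama:
  assumes U: "ideal U R" and K: "ideal K R" and x: "x \<in> \<mm>" and sub: "U \<subseteq> add_multiples R U K x"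
  shows "U \<subseteq> K"
proof (rule ccontr)
  note carr = ideal_carrier[OF U] ideal_carrier[OF K]
  have xc: "x \<in> carrier R" using \<mm>_carrier x .
  define V where "V y = add_multiples R (carrier R) K y" for y
  have V: "ideal (V y) R" if "y \<in> U" for y
    unfolding V_def using add_multiples_ideal[OF oneideal K] carr that by blast
  assume "\<not> U \<subseteq> K"
  obtain M where M: "M \<in> V ` (U - K)" and max: "\<And>J. J \<in> V ` (U - K) \<Longrightarrow> M \<subseteq> J \<Longrightarrow> J = M"
    by (rule exists_maximal_member[of "V ` (U - K)"]) (use \<open>\<not> U \<subseteq> K\<close> V in auto)
  then obtain y where y: "y \<in> U" "y \<notin> K" "M = V y" by auto
  then obtain k y' where ky': "k \<in> K" "y' \<in> U" and yeq: "y = k \<oplus> x \<otimes> y'"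
    using sub by (auto simp: add_multiples_def)
  have c: "k \<in> carrier R" "y' \<in> carrier R" "y \<in> carrier R" using ky' y carr by auto
  have y'K: "y' \<notin> K"
  proof
    assume "y' \<in> K"
    then have "y \<in> K" using ideal_add[OF K] ideal_mult[OF K xc] ky' unfolding yeq by blast
    with y show False by simp
  qed
  have "M \<subseteq> V y'"
  proof
    fix u assume "u \<in> M"
    then obtain l z where lz: "l \<in> K" "z \<in> carrier R" and u: "u = l \<oplus> y \<otimes> z"
      unfolding y V_def by (auto simp: add_multiples_def)
    have d: "l \<in> carrier R" using lz carr by auto
    have "u = (l \<oplus> k \<otimes> z) \<oplus> y' \<otimes> (x \<otimes> z)"
      unfolding u yeq using c d lz(2) xc by algebra
    moreover have "l \<oplus> k \<otimes> z \<in> K" using ideal_add[OF K] ideal_mult_right[OF K] lz ky' by blast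
    ultimately show "u \<in> V y'" unfolding V_def using lz xc by (intro add_multiplesI) auto
  qed
  then have "V y' = M" using max ky' y'K by blast
  moreover have "y' \<in> V y'"
    using multiple_in_add_multiples[OF oneideal K c(2) one_closed] c by (simp add: V_def)
  ultimately have "y' \<in> V y" using y by simp
  then obtain l z where lz: "l \<in> K" "z \<in> carrier R" and y': "y' = l \<oplus> y \<otimes> z"
    unfolding V_def by (auto simp: add_multiples_def)
  have d: "l \<in> carrier R" using lz carr by auto
  have "(\<one> \<ominus> z \<otimes> x) \<otimes> y' = y' \<ominus> z \<otimes> (x \<otimes> y')"
    using c d lz(2) xc by algebra
  also have "\<dots> = (l \<oplus> (k \<oplus> x \<otimes> y') \<otimes> z) \<ominus> z \<otimes> (x \<otimes> y')"
    using y' yeq by simp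
  also have "\<dots> = l \<oplus> z \<otimes> k"
    using c d lz(2) xc by algebra
  finally have "(\<one> \<ominus> z \<otimes> x) \<otimes> y' \<in> K" using ideal_add[OF K] ideal_mult[OF K] lz ky' by simp
  then show False using cancel_one_minus[OF K x lz(2) c(2)] y'K by blast
qed

lemma generic_set_\<mm>: "generic_set R \<mm> \<mm>"
  unfolding generic_set_def
proof (intro conjI allI impI)
  fix F assume F: "finite F" "\<forall>P\<in>F. primeideal P R \<and> P \<noteq> \<mm>"
  show "\<exists>z\<in>\<mm>. \<forall>P\<in>F. z \<notin> P"
  proof (rule prime_avoidance[OF F(1) _ \<mm>_ideal])
    fix P assume P: "P \<in> F"
    then interpret P: primeideal P R using F by blast
    have "\<one> \<notin> P" using P.I_notcarr P.one_imp_carrier by blast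
    then show "\<not> \<mm> \<subseteq> P" using proper_ideal_subset[OF P.is_ideal] F P by blast
    show "primeideal P R" by (rule P.primeideal)
  qed
qed simp

context
  fixes E :: "'a set"
  assumes E: "ideal E R"
begin

text \<open>Apply the genericity of \<open>B\<close> to the associated primes of both modules; \<open>\<mm>\<close> is not among them, as the
socles vanish.\<close>

lemma exists_common_regular:
  assumes B: "generic_set R \<mm> B" and E': "ideal E' R" and K: "ideal K R" and K': "ideal K' R"
    and soc: "\<not> has_socle R \<mm> E K" and soc': "\<not> has_socle R \<mm> E' K'"
  obtains z where "z \<in> B" "regular_mod R E K z" "regular_mod R E' K' z"
proof -
  obtain F where F: "finite F" "\<And>P. P \<in> F \<Longrightarrow> primeideal P R"
    "\<And>P. P \<in> F \<Longrightarrow> \<exists>u\<in>E. u \<notin> K \<and> P = {r \<in> carrier R. r \<otimes> u \<in> K}"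
    "\<And>x. x \<in> carrier R \<Longrightarrow> \<not> regular_mod R E K x \<Longrightarrow> \<exists>P\<in>F. x \<in> P"
    by (rule finite_associated_primes[OF E K]) blast
  obtain F' where F': "finite F'" "\<And>P. P \<in> F' \<Longrightarrow> primeideal P R"
    "\<And>P. P \<in> F' \<Longrightarrow> \<exists>u\<in>E'. u \<notin> K' \<and> P = {r \<in> carrier R. r \<otimes> u \<in> K'}"
    "\<And>x. x \<in> carrier R \<Longrightarrow> \<not> regular_mod R E' K' x \<Longrightarrow> \<exists>P\<in>F'. x \<in> P"
    by (rule finite_associated_primes[OF E' K']) blast
  have "P \<noteq> \<mm>" if "P \<in> F" for P using F(3)[OF that] soc by (auto simp: has_socle_def)
  moreover have "P \<noteq> \<mm>" if "P \<in> F'" for P using F'(3)[OF that] soc' by (auto simp: has_socle_def)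
  ultimately have "\<exists>z\<in>B. \<forall>P\<in>F \<union> F'. z \<notin> P"
    using B F(1,2) F'(1,2) unfolding generic_set_def by (metis UnE finite_UnI)
  then obtain z where z: "z \<in> B" "\<forall>P\<in>F \<union> F'. z \<notin> P" by blast
  then have "z \<in> carrier R" using B \<mm>_carrier unfolding generic_set_def by blast
  then have "regular_mod R E K z" "regular_mod R E' K' z"
    using F(4)[of z] F'(4)[of z] z(2) by blast+
  then show ?thesis using that z by blast
qed

text \<open>Induction on \<open>n\<close>. Let \<open>x\<close> be the first member of the given sequence. The socle of \<open>E / (K + x E)\<close> vanishes,
hence so does that of \<open>E / (K + z E)\<close> by exchange, and some \<open>w\<close> is regular on both quotients. The induction
hypothesis, applied first to \<open>K + x E\<close> and \<open>w\<close>, and after permuting to \<open>K + w E\<close> and \<open>z\<close>, yields the sequence that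
\<open>w\<close> completes.\<close>

lemma regular_length_drop:
  assumes "ideal K R" "length xs = Suc n" "set xs \<subseteq> \<mm>" "weakly_regular R E K xs"
    and "z \<in> \<mm>" "regular_mod R E K z"
  shows "\<exists>ys. length ys = n \<and> set ys \<subseteq> \<mm> \<and> weakly_regular R E (add_multiples R E K z) ys"
  using assms
proof (induction n arbitrary: K xs z)
  case 0
  then show ?case by (intro exI[of _ "[]"]) simp
next
  case (Suc n)
  note K = Suc.prems(1) and z = Suc.prems(5) and regz = Suc.prems(6)
  obtain x xs' where xs: "xs = x # xs'" using Suc.prems(2) by (cases xs) auto
  obtain x' xs'' where xs': "xs' = x' # xs''" using Suc.prems(2) xs by (cases xs') auto
  let ?q = "add_multiples R E"
  have x: "x \<in> \<mm>" "regular_mod R E K x" "x' \<in> \<mm>" "regular_mod R E (?q K x) x'"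
    and len: "length xs' = Suc n" "set xs' \<subseteq> \<mm>" "weakly_regular R E (?q K x) xs'"
    using Suc.prems by (auto simp: xs xs')
  have xc: "x \<in> carrier R" and zc: "z \<in> carrier R" using \<mm>_carrier x z by auto
  note Kx = add_multiples_ideal[OF E K xc] and Kz = add_multiples_ideal[OF E K zc]
  have socx: "\<not> has_socle R \<mm> E (?q K x)" using regular_mod_no_socle[OF E Kx x(3,4)] .
  then have socz: "\<not> has_socle R \<mm> E (?q K z)"
    using socle_exchange[OF E K _ zc x(1) regz x(2)] \<mm>_carrier by blast
  obtain w where w: "w \<in> \<mm>" "regular_mod R E (?q K x) w" "regular_mod R E (?q K z) w"
    by (rule exists_common_regular[OF generic_set_\<mm> E Kx Kz socx socz])
  have wc: "w \<in> carrier R" using \<mm>_carrier w by auto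
  note Kw = add_multiples_ideal[OF E K wc]
  obtain ys where ys: "length ys = n" "set ys \<subseteq> \<mm>" "weakly_regular R E (?q (?q K x) w) ys"
    using Suc.IH[OF Kx len w(1,2)] by blast
  have regxw: "regular_mod R E (?q K w) x" by (rule regular_mod_swap[OF E K xc wc x(2) w(2)])
  have regzw: "regular_mod R E (?q K w) z" by (rule regular_mod_swap[OF E K zc wc regz w(3)])
  have "weakly_regular R E (?q K w) (x # ys)"
    using regxw ys add_multiples_commute[OF E K wc xc] by simp
  then obtain zs where zs: "length zs = n" "set zs \<subseteq> \<mm>" "weakly_regular R E (?q (?q K w) z) zs"
    using Suc.IH[OF Kw, of "x # ys" z] ys(1,2) x(1) z regzw by auto
  have "weakly_regular R E (?q K z) (w # zs)"
    using w zs add_multiples_commute[OF E K wc zc] by simp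
  then show ?case using zs w by (intro exI[of _ "w # zs"]) auto
qed

end

text \<open>The first member is a common regular element from \<open>B\<close>; dividing it out leaves regular sequences of length
\<open>n - 1\<close> on both sides.\<close>

lemma exists_common_regular_sequence:
  assumes B: "generic_set R \<mm> B" and E: "ideal E R" and E': "ideal E' R"
    and "ideal K R" "ideal K' R"
    and "length xs = n" "set xs \<subseteq> \<mm>" "weakly_regular R E K xs"
    and "length ys = n" "set ys \<subseteq> \<mm>" "weakly_regular R E' K' ys"
  shows "\<exists>zs. length zs = n \<and> set zs \<subseteq> B \<and> weakly_regular R E K zs \<and> weakly_regular R E' K' zs"
  using assms(4-)
proof (induction n arbitrary: K K' xs ys)
  case 0
  then show ?case by (intro exI[of _ "[]"]) simp
next
  case (Suc n)
  note K = Suc.prems(1) and K' = Suc.prems(2)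
  obtain x xs' where xs: "xs = x # xs'" using Suc.prems(3) by (cases xs) auto
  obtain y ys' where ys: "ys = y # ys'" using Suc.prems(6) by (cases ys) auto
  have soc: "\<not> has_socle R \<mm> E K" "\<not> has_socle R \<mm> E' K'"
    using regular_mod_no_socle[OF E K, of x] regular_mod_no_socle[OF E' K', of y] Suc.prems
    by (auto simp: xs ys)
  obtain z where z: "z \<in> B" "regular_mod R E K z" "regular_mod R E' K' z"
    by (rule exists_common_regular[OF E B E' K K' soc])
  have zm: "z \<in> \<mm>" using z B by (auto simp: generic_set_def)
  have zc: "z \<in> carrier R" using \<mm>_carrier zm by auto
  obtain us where us: "length us = n" "set us \<subseteq> \<mm>" "weakly_regular R E (add_multiples R E K z) us"
    using regular_length_drop[OF E K Suc.prems(3-5) zm z(2)] by blast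
  obtain vs where vs: "length vs = n" "set vs \<subseteq> \<mm>" "weakly_regular R E' (add_multiples R E' K' z) vs"
    using regular_length_drop[OF E' K' Suc.prems(6-8) zm z(3)] by blast
  obtain zs where "length zs = n" "set zs \<subseteq> B" "weakly_regular R E (add_multiples R E K z) zs"
    "weakly_regular R E' (add_multiples R E' K' z) zs"
    using Suc.IH[OF add_multiples_ideal[OF E K zc] add_multiples_ideal[OF E' K' zc] us vs] by blast
  then show ?case using z by (intro exI[of _ "z # zs"]) auto
qed

end

section \<open>Depth and dimension\<close>

definition prime_chain :: "('a, 'm) ring_scheme \<Rightarrow> nat \<Rightarrow> (nat \<Rightarrow> 'a set) \<Rightarrow> bool"
  where "prime_chain R n P \<longleftrightarrow> (\<forall>i\<le>n. primeideal (P i) R) \<and> (\<forall>i<n. P i \<subset> P (Suc i))"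

lemma krull_dim_prime_chain: "krull_dim R = Sup {enat n | n. \<exists>P. prime_chain R n P}"
  by (simp add: krull_dim_def prime_chain_def)

lemma prime_chain_le_krull_dim: "prime_chain R n P \<Longrightarrow> enat n \<le> krull_dim R"
  unfolding krull_dim_prime_chain by (rule Sup_upper) blast

lemma krull_dim_leI:
  assumes "\<And>n P. prime_chain R n P \<Longrightarrow> enat n \<le> d"
  shows "krull_dim R \<le> d"
  unfolding krull_dim_prime_chain by (rule Sup_least) (use assms in blast)

lemma prime_chain_Cons:
  assumes "prime_chain R n P" "primeideal Q R" "Q \<subset> P 0"
  shows "prime_chain R (Suc n) (case_nat Q P)"
  unfolding prime_chain_def
proof (intro conjI allI impI)
  show "primeideal (case_nat Q P i) R" if "i \<le> Suc n" for i
    using that assms by (cases i) (auto simp: prime_chain_def)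
  show "case_nat Q P i \<subset> case_nat Q P (Suc i)" if "i < Suc n" for i
    using that assms by (cases i) (auto simp: prime_chain_def)
qed

text \<open>A supremum of extended natural numbers that is at least \<open>n\<close> is attained up to \<open>n\<close>, as \<open>n\<close> has a predecessor
unless it is zero.\<close>

lemma enat_le_Sup_attained:
  fixes A :: "enat set"
  assumes "enat n \<le> Sup A" "A \<noteq> {}"
  shows "\<exists>x\<in>A. enat n \<le> x"
proof (rule ccontr)
  assume "\<not> ?thesis"
  then have less: "\<And>x. x \<in> A \<Longrightarrow> x < enat n" by auto
  with assms(2) obtain m where m: "n = Suc m"
    by (cases n) (auto simp: zero_enat_def[symmetric])
  have "x \<le> enat m" if "x \<in> A" for x
    using less[OF that] unfolding m by (cases x) auto
  then have "Sup A \<le> enat m" by (rule Sup_least)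
  then have "enat n \<le> enat m" using assms(1) by (rule order_trans[rotated])
  then show False using m by simp
qed

lemma (in ring_hom_cring) prime_vimage:
  assumes "primeideal P S"
  shows "primeideal {r \<in> carrier R. h r \<in> P} R"
  by (rule ring_hom_ring.primeideal_vimage[OF ring_hom_ringI2[OF R.ring_axioms S.ring_axioms homh]
      R.is_cring assms])

context cring
begin

lemma module_ideal_module:
  assumes E: "ideal E R"
  shows "module R (ideal_module R E)"
proof (rule moduleI[OF is_cring])
  note carr = ideal_carrier[OF E]
  show "abelian_group (ideal_module R E)"
  proof (rule abelian_groupI)
    fix x assume x: "x \<in> carrier (ideal_module R E)"
    then have "(\<ominus> \<one>) \<otimes> x \<in> E" using ideal_mult[OF E, of "\<ominus> \<one>" x] by simp
    moreover have "(\<ominus> \<one>) \<otimes> x = \<ominus> x" using x carr by (simp add: l_minus)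
    ultimately show "\<exists>y\<in>carrier (ideal_module R E). y \<oplus>\<^bsub>ideal_module R E\<^esub> x = \<zero>\<^bsub>ideal_module R E\<^esub>"
      using x carr by (intro bexI[of _ "\<ominus> x"]) (auto simp: self_module_def l_neg)
  qed (use carr ideal_zero[OF E] ideal_add[OF E] in \<open>auto simp: self_module_def a_assoc intro: a_comm\<close>)
qed (use ideal_carrier[OF E] ideal_mult[OF E] in \<open>auto simp: self_module_def l_distr r_distr m_assoc\<close>)

lemma submodule_ideal_module_iff:
  assumes E: "ideal E R"
  shows "submodule N R (ideal_module R E) \<longleftrightarrow> ideal N R \<and> N \<subseteq> E"
proof
  interpret M: module R "ideal_module R E" by (rule module_ideal_module[OF E])
  note carr = ideal_carrier[OF E]
  {
    assume "submodule N R (ideal_module R E)"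
    note N = M.submoduleE[OF this]
    have NE: "N \<subseteq> E" using N(1) by simp
    obtain x where "x \<in> N" using N(2) by blast
    then have z: "\<zero> \<in> N" using N(4)[of \<zero> x] NE carr by (auto simp: self_module_def)
    have "ideal N R"
      by (rule idealI_cring) (use z NE carr N(4,5) in \<open>auto simp: self_module_def\<close>)
    with NE show "ideal N R \<and> N \<subseteq> E" by simp
  next
    assume N: "ideal N R \<and> N \<subseteq> E"
    then have id: "ideal N R" by simp
    show "submodule N R (ideal_module R E)"
    proof (rule M.submoduleI)
      fix x assume x: "x \<in> N"
      then have xM: "x \<in> carrier (ideal_module R E)" using N by auto
      have "(\<ominus> \<one>) \<odot>\<^bsub>ideal_module R E\<^esub> x \<in> N"
        using ideal_mult[OF id, of "\<ominus> \<one>" x] x by (simp add: self_module_def)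
      then show "\<ominus>\<^bsub>ideal_module R E\<^esub> x \<in> N"
        using M.smult_l_minus[OF one_closed xM] M.smult_one[OF xM] by simp
    qed (use N ideal_zero[OF id] ideal_add[OF id] ideal_mult[OF id] in \<open>auto simp: self_module_def\<close>)
  }
qed

abbreviation "multiples_mod E K xs \<equiv> foldl (add_multiples R E) K xs"

lemma multiples_mod_ideal:
  assumes "ideal E R" "ideal K R" "set xs \<subseteq> carrier R"
  shows "ideal (multiples_mod E K xs) R"
  using assms(2,3) by (induction xs arbitrary: K) (auto intro: add_multiples_ideal[OF assms(1)])

lemma multiples_mod_least:
  assumes E: "ideal E R" and K: "ideal K R" and xs: "set xs \<subseteq> carrier R"
    and N: "ideal N R" "K \<subseteq> N" "\<And>x y. x \<in> set xs \<Longrightarrow> y \<in> E \<Longrightarrow> x \<otimes> y \<in> N"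
  shows "multiples_mod E K xs \<subseteq> N"
  using K xs N(2,3)
proof (induction xs arbitrary: K)
  case (Cons x xs)
  have "add_multiples R E K x \<subseteq> N"
    using Cons.prems ideal_add[OF N(1)] by (auto simp: add_multiples_def)
  then show ?case
    using Cons.IH[OF add_multiples_ideal[OF E Cons.prems(1)]] Cons.prems by auto
qed simp

lemma multiples_mod_subset:
  assumes "ideal E R" "ideal K R" "set xs \<subseteq> carrier R" "K \<subseteq> E"
  shows "multiples_mod E K xs \<subseteq> E"
  by (rule multiples_mod_least[OF assms(1-3) assms(1,4)]) (use assms in \<open>auto intro: ideal_mult\<close>)

lemma multiples_mod_incr:
  assumes E: "ideal E R" and K: "ideal K R" and xs: "set xs \<subseteq> carrier R"
  shows "K \<subseteq> multiples_mod E K xs"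
  using K xs
proof (induction xs arbitrary: K)
  case (Cons a xs)
  then have a: "a \<in> carrier R" by simp
  show ?case
    using Cons.IH[OF add_multiples_ideal[OF E Cons.prems(1) a]] subset_add_multiples[OF E Cons.prems(1) a]
      Cons.prems by auto
qed simp

lemma multiple_in_multiples_mod:
  assumes E: "ideal E R" and "ideal K R" "set xs \<subseteq> carrier R" "x \<in> set xs" and y: "y \<in> E"
  shows "x \<otimes> y \<in> multiples_mod E K xs"
  using assms(2-4)
proof (induction xs arbitrary: K)
  case (Cons a xs)
  then have a: "a \<in> carrier R" "set xs \<subseteq> carrier R" by simp_all
  note id = add_multiples_ideal[OF E Cons.prems(1) a(1)]
  show ?case
    using Cons.IH[OF id] multiples_mod_incr[OF E id a(2)]
      multiple_in_add_multiples[OF E Cons.prems(1) a(1) y] Cons.prems by auto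
qed simp

lemma generated_multiple_ideal_module:
  assumes E: "ideal E R" and xs: "set xs \<subseteq> carrier R"
  shows "generated_multiple R (ideal_module R E) (set xs) = multiples_mod E {\<zero>} xs"
proof -
  have zE: "{\<zero>} \<subseteq> E" using ideal_zero[OF E] by simp
  note up = multiples_mod_incr[OF E zeroideal xs] multiple_in_multiples_mod[OF E zeroideal xs]
  let ?S = "{s \<otimes> x | s x. s \<in> set xs \<and> x \<in> E}"
  have "generated_multiple R (ideal_module R E) (set xs) = \<Inter>{N. (ideal N R \<and> N \<subseteq> E) \<and> ?S \<subseteq> N}"
    unfolding generated_multiple_def submodule_span_def submodule_ideal_module_iff[OF E]
    by (simp add: self_module_def)
  also have "\<dots> = multiples_mod E {\<zero>} xs"
  proof
    show "\<Inter>{N. (ideal N R \<and> N \<subseteq> E) \<and> ?S \<subseteq> N} \<subseteq> multiples_mod E {\<zero>} xs"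
      by (rule Inter_lower)
        (use multiples_mod_ideal[OF E zeroideal xs] multiples_mod_subset[OF E zeroideal xs zE] up
          in auto)
    show "multiples_mod E {\<zero>} xs \<subseteq> \<Inter>{N. (ideal N R \<and> N \<subseteq> E) \<and> ?S \<subseteq> N}"
    proof (rule Inter_greatest)
      fix N assume N: "N \<in> {N. (ideal N R \<and> N \<subseteq> E) \<and> ?S \<subseteq> N}"
      then have id: "ideal N R" and "?S \<subseteq> N" by simp_all
      then have "\<And>x y. x \<in> set xs \<Longrightarrow> y \<in> E \<Longrightarrow> x \<otimes> y \<in> N" by blast
      then show "multiples_mod E {\<zero>} xs \<subseteq> N"
        using multiples_mod_least[OF E zeroideal xs id] ideal_zero[OF id] by simp
    qed
  qed
  finally show ?thesis .
qed

lemma weakly_regular_nth: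
  "weakly_regular R E K xs \<longleftrightarrow>
    (\<forall>i<length xs. regular_mod R E (multiples_mod E K (take i xs)) (xs ! i))"
  by (induction xs arbitrary: K) (auto simp: All_less_Suc2)

lemma weakly_regular_take:
  "weakly_regular R E K xs \<Longrightarrow> weakly_regular R E K (take n xs)"
  by (simp add: weakly_regular_nth min_def)

lemma regular_sequence_ideal_module:
  assumes E: "ideal E R"
  shows "regular_sequence R (ideal_module R E) xs \<longleftrightarrow>
    set xs \<subseteq> carrier R \<and> weakly_regular R E {\<zero>} xs \<and> multiples_mod E {\<zero>} xs \<noteq> E"
proof (cases "set xs \<subseteq> carrier R")
  case True
  then have "set (take i xs) \<subseteq> carrier R" for i using set_take_subset[of i xs] by blast
  then show ?thesis
    using True unfolding regular_sequence_def weakly_regular_nth regular_mod_def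
    by (simp add: generated_multiple_ideal_module[OF E]) (simp add: self_module_def)
qed (simp add: regular_sequence_def)

lemma self_module_eq: "self_module R = ideal_module R (carrier R)"
  by (simp add: self_module_def)

lemma ideal_annihilator:
  assumes E: "ideal E R"
  shows "ideal (annihilator R (ideal_module R E)) R"
  unfolding annihilator_def
  by (rule idealI_cring)
    (use ideal_carrier[OF E] in \<open>auto simp: self_module_def l_distr m_assoc\<close>)

lemma prime_chain_quotient:
  assumes J: "ideal J R" and P: "prime_chain R n P" and JP: "J \<subseteq> P 0"
  shows "prime_chain (R Quot J) n (\<lambda>i. (+>) J ` P i)"
proof -
  interpret J: ideal J R by fact
  interpret h: ring_hom_cring R "R Quot J" "(+>) J" by (rule J.rcos_ring_hom_cring[OF is_cring])
  have JPi: "J \<subseteq> P i" if "i \<le> n" for i using that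
  proof (induction i)
    case (Suc i)
    then show ?case using P unfolding prime_chain_def by (meson Suc_leD Suc_le_lessD order_trans psubsetE)
  qed (use JP in simp)
  have idP: "ideal (P i) R" if "i \<le> n" for i using P that by (simp add: prime_chain_def primeideal_def)
  have mem: "x \<in> P i" if "i \<le> n" "x \<in> carrier R" "J +> x \<in> (+>) J ` P i" for i x
  proof -
    from that(3) obtain p where p: "J +> x = J +> p" "p \<in> P i" by (rule imageE)
    have pc: "p \<in> carrier R" using ideal_carrier[OF idP[OF that(1)] p(2)] .
    then have "x \<ominus> p \<in> J"
      using quotient_eq_iff_same_a_r_cos[OF J that(2) pc] p(1) by simp
    then have "p \<oplus> (x \<ominus> p) \<in> P i"
      using ideal_add[OF idP[OF that(1)] p(2)] JPi[OF that(1)] by blast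
    moreover have "p \<oplus> (x \<ominus> p) = x" using pc that(2) by algebra
    ultimately show ?thesis by simp
  qed
  have prime: "primeideal ((+>) J ` P i) (R Quot J)" if i: "i \<le> n" for i
  proof (rule primeidealI)
    interpret P: primeideal "P i" R using P i by (simp add: prime_chain_def)
    show "ideal ((+>) J ` P i) (R Quot J)" by (rule ring_ideal_imp_quot_ideal[OF J P.is_ideal])
    show "cring (R Quot J)" by (rule h.S.is_cring)
    have "\<one> \<notin> P i" using P.I_notcarr P.one_imp_carrier by blast
    then have "J +> \<one> \<notin> (+>) J ` P i" using mem[OF i one_closed] by blast
    moreover have "J +> \<one> \<in> carrier (R Quot J)" by simp
    ultimately show "carrier (R Quot J) \<noteq> (+>) J ` P i" by blast
    fix u v assume uv: "u \<in> carrier (R Quot J)" "v \<in> carrier (R Quot J)"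
      and prod: "u \<otimes>\<^bsub>R Quot J\<^esub> v \<in> (+>) J ` P i"
    obtain x y where xy: "x \<in> carrier R" "y \<in> carrier R" "u = J +> x" "v = J +> y"
      using uv unfolding FactRing_def A_RCOSETS_def' by auto
    have "J +> (x \<otimes> y) \<in> (+>) J ` P i" using prod xy h.hom_mult by simp
    then have "x \<otimes> y \<in> P i" using mem[OF i] xy by simp
    then show "u \<in> (+>) J ` P i \<or> v \<in> (+>) J ` P i" using P.I_prime xy by blast
  qed
  moreover have "(+>) J ` P i \<subset> (+>) J ` P (Suc i)" if i: "i < n" for i
  proof -
    have sub: "P i \<subset> P (Suc i)" using P i by (simp add: prime_chain_def)
    then obtain x where x: "x \<in> P (Suc i)" "x \<notin> P i" by blast
    have "J +> x \<notin> (+>) J ` P i"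
      using mem[of i x] x i ideal_carrier[OF idP[of "Suc i"]] by auto
    then show ?thesis using sub x by blast
  qed
  ultimately show ?thesis by (simp add: prime_chain_def)
qed

lemma krull_dim_quotient_le:
  assumes J: "ideal J R"
  shows "krull_dim (R Quot J) \<le> krull_dim R"
proof (rule krull_dim_leI)
  interpret J: ideal J R by fact
  interpret h: ring_hom_cring R "R Quot J" "(+>) J" by (rule J.rcos_ring_hom_cring[OF is_cring])
  fix n P assume P: "prime_chain (R Quot J) n P"
  have "prime_chain R n (\<lambda>i. {r \<in> carrier R. J +> r \<in> P i})"
    unfolding prime_chain_def
  proof (intro conjI allI impI)
    show "primeideal {r \<in> carrier R. J +> r \<in> P i} R" if "i \<le> n" for i
      using h.prime_vimage P that by (simp add: prime_chain_def)
    fix i assume i: "i < n"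
    then have sub: "P i \<subset> P (Suc i)" and "primeideal (P (Suc i)) (R Quot J)"
      using P by (auto simp: prime_chain_def)
    then obtain u where u: "u \<in> P (Suc i)" "u \<notin> P i" "u \<in> carrier (R Quot J)"
      using h.S.ideal_carrier primeideal_def by blast
    then obtain r where "r \<in> carrier R" "u = J +> r" unfolding FactRing_def A_RCOSETS_def' by auto
    then show "{r \<in> carrier R. J +> r \<in> P i} \<subset> {r \<in> carrier R. J +> r \<in> P (Suc i)}"
      using u sub by blast
  qed
  then show "enat n \<le> krull_dim R" by (rule prime_chain_le_krull_dim)
qed

end

context noetherian_cring
begin

lemma finitely_generated_ideal_module:
  assumes E: "ideal E R"
  shows "finitely_generated_module R (ideal_module R E)"
proof -
  obtain A where A: "A \<subseteq> carrier R" "finite A" "E = Idl A" using finetely_gen[OF E] by blast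
  have AE: "A \<subseteq> E" using genideal_self A by blast
  have "submodule_span R (ideal_module R E) A = \<Inter>{N. (ideal N R \<and> N \<subseteq> E) \<and> A \<subseteq> N}"
    by (simp add: submodule_span_def submodule_ideal_module_iff[OF E])
  also have "\<dots> = E"
  proof
    show "\<Inter>{N. (ideal N R \<and> N \<subseteq> E) \<and> A \<subseteq> N} \<subseteq> E" using E AE by blast
    show "E \<subseteq> \<Inter>{N. (ideal N R \<and> N \<subseteq> E) \<and> A \<subseteq> N}" using A(3) genideal_minimal by blast
  qed
  finally show ?thesis
    unfolding finitely_generated_module_def using A AE by auto
qed

text \<open>The reason for depth being at most dimension. Given a chain of primes over the annihilator of
\<open>E / (K + x E)\<close> with least member \<open>P\<^sub>0\<close>, which contains \<open>x\<close>, let \<open>T\<close> consist of the products \<open>s x\<^sup>n\<close> with \<open>s\<close> outside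
\<open>P\<^sub>0\<close>. As \<open>x\<close> is regular, the annihilator of \<open>E / K\<close> does not meet \<open>T\<close>: it is contained in \<open>P\<^sub>0\<close>, and powers of \<open>x\<close>
can be cancelled. A prime over this annihilator that is disjoint from \<open>T\<close> lies in \<open>P\<^sub>0\<close> and does not contain \<open>x\<close>,
so it extends the chain downwards.\<close>

lemma prime_chain_of_weakly_regular:
  assumes E: "ideal E R" and "ideal K R" "K \<subseteq> E" "set xs \<subseteq> carrier R"
    and "weakly_regular R E K xs" "multiples_mod E K xs \<noteq> E"
  shows "\<exists>P. prime_chain R (length xs) P \<and> {r \<in> carrier R. \<forall>y\<in>E. r \<otimes> y \<in> K} \<subseteq> P 0"
  using assms(2-)
proof (induction xs arbitrary: K)
  have ann: "ideal {r \<in> carrier R. \<forall>y\<in>E. r \<otimes> y \<in> K} R" if K: "ideal K R" for K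
    by (rule idealI_cring)
      (use ideal_carrier[OF E] ideal_zero[OF K] ideal_add[OF K] ideal_mult[OF K]
        in \<open>auto simp: l_distr m_assoc\<close>)
  {
    case Nil
    have "\<one> \<notin> {r \<in> carrier R. \<forall>y\<in>E. r \<otimes> y \<in> K}" using Nil ideal_carrier[OF E] by auto
    then obtain P where "primeideal P R" "{r \<in> carrier R. \<forall>y\<in>E. r \<otimes> y \<in> K} \<subseteq> P"
      using exists_prime_disjoint[OF ann[OF Nil(1)], of "{\<one>}"] by auto
    then show ?case by (intro exI[of _ "\<lambda>_. P"]) (simp add: prime_chain_def)
  next
    case (Cons x xs)
    have x: "x \<in> carrier R" using Cons.prems by simp
    note K = Cons.prems(1) and KE = Cons.prems(2)
    let ?J = "{r \<in> carrier R. \<forall>y\<in>E. r \<otimes> y \<in> K}"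
    obtain P where P: "prime_chain R (length xs) P"
      "{r \<in> carrier R. \<forall>y\<in>E. r \<otimes> y \<in> add_multiples R E K x} \<subseteq> P 0"
      using Cons.IH[OF add_multiples_ideal[OF E K x] add_multiples_subset[OF E K x KE]] Cons.prems
      by auto
    interpret P0: primeideal "P 0" R using P by (simp add: prime_chain_def)
    have one: "\<one> \<notin> P 0" using P0.I_notcarr P0.one_imp_carrier by blast
    have xP: "x \<in> P 0" using P(2) multiple_in_add_multiples[OF E K x] x by blast
    have JP: "?J \<subseteq> P 0" using P(2) subset_add_multiples[OF E K x] by blast
    define T where "T = {s \<otimes> x [^] n | s (n::nat). s \<in> carrier R - P 0}"
    have mult: "s \<otimes> t \<in> T" if sT: "s \<in> T" and tT: "t \<in> T" for s t
    proof -
      obtain s' and m :: nat where s: "s' \<in> carrier R - P 0" "s = s' \<otimes> x [^] m"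
        using sT unfolding T_def by blast
      obtain t' and n :: nat where t: "t' \<in> carrier R - P 0" "t = t' \<otimes> x [^] n"
        using tT unfolding T_def by blast
      have "s \<otimes> t = (s' \<otimes> t') \<otimes> (x [^] m \<otimes> x [^] n)"
        using s t x by (simp add: m_ac)
      also have "x [^] m \<otimes> x [^] n = x [^] (m + n)" by (rule nat_pow_mult[OF x])
      finally have eq: "s \<otimes> t = (s' \<otimes> t') \<otimes> x [^] (m + n)" .
      have "s' \<otimes> t' \<in> carrier R - P 0" using s t P0.I_prime by auto
      then show ?thesis unfolding T_def eq by blast
    qed
    have in_T: "s \<in> T" if "s \<in> carrier R - P 0" for s
      unfolding T_def using that by (intro CollectI exI[of _ s] exI[of _ "0::nat"]) auto
    have "x = \<one> \<otimes> x [^] (1::nat)" using x by simp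
    then have xT: "x \<in> T" unfolding T_def using one by blast
    have "?J \<inter> T = {}"
    proof (rule ccontr)
      assume "?J \<inter> T \<noteq> {}"
      then obtain s and n :: nat where s: "s \<in> carrier R - P 0" "s \<otimes> x [^] n \<in> ?J"
        unfolding T_def by blast
      have "s \<otimes> y \<in> K" if y: "y \<in> E" for y
      proof -
        have yc: "y \<in> carrier R" using ideal_carrier[OF E y] .
        have "s \<otimes> y \<in> K" if "x [^] n \<otimes> (s \<otimes> y) \<in> K" for n :: nat
          using that
        proof (induction n)
          case (Suc n)
          have "x \<otimes> (x [^] n \<otimes> (s \<otimes> y)) \<in> K" using Suc.prems s yc x by (simp add: m_ac)
          moreover have "x [^] n \<otimes> (s \<otimes> y) \<in> E" using ideal_mult[OF E] s y x by simp
          ultimately show ?case using Suc.IH Cons.prems(4) by (simp add: regular_mod_def)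
        qed (use s yc in simp)
        moreover have "x [^] n \<otimes> (s \<otimes> y) \<in> K" using s y yc x by (auto simp: m_ac)
        ultimately show ?thesis .
      qed
      then have "s \<in> ?J" using s by blast
      then show False using JP s by blast
    qed
    then obtain Q where Q: "primeideal Q R" "?J \<subseteq> Q" "Q \<inter> T = {}"
      using exists_prime_disjoint[OF ann[OF K] in_T mult] one by blast
    have "Q \<subseteq> P 0" using Q(1,3) in_T ideal_carrier primeideal_def by blast
    then have "Q \<subset> P 0" using xP xT Q(3) by blast
    then have "prime_chain R (length (x # xs)) (case_nat Q P)"
      using prime_chain_Cons[OF P(1) Q(1)] by simp
    then show ?case using Q(2) by (intro exI[of _ "case_nat Q P"]) auto
  }
qed

lemma depth_le_module_dim:
  assumes E: "ideal E R"
  shows "depth R (ideal_module R E) \<le> module_dim R (ideal_module R E)"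
  unfolding depth_def
proof (rule Sup_least)
  let ?J = "annihilator R (ideal_module R E)"
  fix l assume "l \<in> {enat (length xs) | xs. regular_sequence R (ideal_module R E) xs \<and> set xs \<subseteq> max_ideal R}"
  then obtain xs where l: "l = enat (length xs)" and xs: "regular_sequence R (ideal_module R E) xs" by blast
  have "{\<zero>} \<subseteq> E" using ideal_zero[OF E] by simp
  then obtain P where P: "prime_chain R (length xs) P" "{r \<in> carrier R. \<forall>y\<in>E. r \<otimes> y \<in> {\<zero>}} \<subseteq> P 0"
    using prime_chain_of_weakly_regular[OF E zeroideal] xs
    unfolding regular_sequence_ideal_module[OF E] by blast
  have "?J \<subseteq> P 0" using P(2) by (simp add: annihilator_def self_module_def)
  then show "l \<le> module_dim R (ideal_module R E)"
    unfolding l module_dim_def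
    using prime_chain_quotient[OF ideal_annihilator[OF E] P(1)] prime_chain_le_krull_dim by blast
qed

lemma depth_le_krull_dim:
  assumes E: "ideal E R"
  shows "module_dim R (ideal_module R E) \<le> krull_dim R"
    and "depth R (ideal_module R E) \<le> krull_dim R"
proof -
  show "module_dim R (ideal_module R E) \<le> krull_dim R"
    unfolding module_dim_def by (rule krull_dim_quotient_le[OF ideal_annihilator[OF E]])
  then show "depth R (ideal_module R E) \<le> krull_dim R"
    using depth_le_module_dim[OF E] by (rule order_trans[rotated])
qed

end

context noetherian_local
begin

lemma maximalideal_unique: "maximalideal M R \<longleftrightarrow> M = \<mm>"
proof
  assume "maximalideal M R"
  then interpret M: maximalideal M R .
  have "\<one> \<notin> M" using M.I_notcarr M.one_imp_carrier by blast
  then have "M \<subseteq> \<mm>" by (rule proper_ideal_subset[OF M.is_ideal])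
  then show "M = \<mm>" using M.I_maximal[OF \<mm>_ideal] one_notin \<mm>_carrier one_closed by blast
next
  have "maximalideal \<mm> R"
  proof (rule maximalidealI[OF \<mm>_ideal])
    show "carrier R \<noteq> \<mm>" using one_notin one_closed by blast
    fix J assume J: "ideal J R" "\<mm> \<subseteq> J" "J \<subseteq> carrier R"
    then show "J = \<mm> \<or> J = carrier R"
      using proper_ideal_subset[OF J(1)] ideal.one_imp_carrier[OF J(1)] by blast
  qed
  then show "M = \<mm> \<Longrightarrow> maximalideal M R" by simp
qed

lemma local_ring: "local_ring R"
  by (intro local_ring.intro is_cring local_ring_axioms.intro) (simp add: maximalideal_unique)

lemma max_ideal_eq: "max_ideal R = \<mm>"
  by (simp add: max_ideal_def maximalideal_unique)

lemma multiples_mod_proper: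
  assumes E: "ideal E R" and "ideal K R" "K \<subseteq> E" "K \<noteq> E" "set xs \<subseteq> \<mm>"
  shows "multiples_mod E K xs \<noteq> E"
  using assms(2-)
proof (induction xs arbitrary: K)
  case (Cons x xs)
  have x: "x \<in> \<mm>" "x \<in> carrier R" using Cons.prems \<mm>_carrier by auto
  have "add_multiples R E K x \<noteq> E"
    using nakayama[OF E Cons.prems(1) x(1)] Cons.prems(2,3) by blast
  then show ?case
    using Cons.IH[OF add_multiples_ideal[OF E Cons.prems(1) x(2)]
        add_multiples_subset[OF E Cons.prems(1) x(2) Cons.prems(2)]] Cons.prems by simp
qed simp

text \<open>By Nakayama's lemma a sequence in \<open>\<mm>\<close> that is weakly regular on \<open>E\<close> is regular.\<close>

lemma depth_ge_iff:
  assumes E: "ideal E R" and nz: "E \<noteq> {\<zero>}"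
  shows "enat n \<le> depth R (ideal_module R E) \<longleftrightarrow>
    (\<exists>xs. length xs = n \<and> set xs \<subseteq> \<mm> \<and> weakly_regular R E {\<zero>} xs)"
proof -
  have reg: "regular_sequence R (ideal_module R E) xs \<longleftrightarrow> weakly_regular R E {\<zero>} xs" if "set xs \<subseteq> \<mm>" for xs
    using multiples_mod_proper[OF E zeroideal, of xs] that nz ideal_zero[OF E] \<mm>_carrier
    by (auto simp: regular_sequence_ideal_module[OF E])
  let ?A = "{enat (length xs) | xs. regular_sequence R (ideal_module R E) xs \<and> set xs \<subseteq> \<mm>}"
  have depth: "depth R (ideal_module R E) = Sup ?A" by (simp add: depth_def max_ideal_eq)
  show ?thesis
  proof
    assume "enat n \<le> depth R (ideal_module R E)"
    moreover have "enat (length []) \<in> ?A" using reg[of "[]"] by (intro CollectI exI[of _ "[]"]) auto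
    ultimately obtain x where "x \<in> ?A" "enat n \<le> x"
      using enat_le_Sup_attained[of n ?A] unfolding depth by blast
    then obtain xs where xs: "n \<le> length xs" "set xs \<subseteq> \<mm>" "weakly_regular R E {\<zero>} xs" using reg by auto
    then show "\<exists>xs. length xs = n \<and> set xs \<subseteq> \<mm> \<and> weakly_regular R E {\<zero>} xs"
      using weakly_regular_take[OF xs(3), of n] set_take_subset[of n xs]
      by (intro exI[of _ "take n xs"]) auto
  next
    assume "\<exists>xs. length xs = n \<and> set xs \<subseteq> \<mm> \<and> weakly_regular R E {\<zero>} xs"
    then have "enat n \<in> ?A" using reg by blast
    then show "enat n \<le> depth R (ideal_module R E)" unfolding depth by (rule Sup_upper)
  qed
qed

end

lemma noetherian_localI:
  fixes R (structure)
  assumes "local_ring R" "noetherian_ring R"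
  shows "noetherian_local R (max_ideal R)"
proof -
  interpret local_ring R by fact
  interpret noetherian_ring R by fact
  interpret noetherian_cring R by unfold_locales
  have "maximalideal (max_ideal R) R"
    unfolding max_ideal_def by (rule theI'[OF unique_maximalideal])
  then interpret M: maximalideal "max_ideal R" R .
  show ?thesis
  proof (intro noetherian_local.intro noetherian_local_axioms.intro noetherian_cring_axioms)
    show "ideal (max_ideal R) R" by (rule M.is_ideal)
    show "\<one> \<notin> max_ideal R" using M.I_notcarr M.one_imp_carrier by blast
    fix x assume x: "x \<in> carrier R" "x \<notin> max_ideal R"
    show "x \<in> Units R"
    proof (rule ccontr)
      assume nu: "x \<notin> Units R"
      let ?C = "{J. ideal J R \<and> PIdl x \<subseteq> J \<and> \<one> \<notin> J}"
      have "\<one> \<notin> PIdl x"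
      proof
        assume "\<one> \<in> PIdl x"
        then obtain y where "y \<in> carrier R" "\<one> = y \<otimes> x" by (auto simp: cgenideal_def)
        then have "x \<in> Units R" using x m_comm by (auto simp: Units_def)
        with nu show False by simp
      qed
      then have "PIdl x \<in> ?C" using cgenideal_ideal[OF x(1)] by blast
      then obtain N where N: "N \<in> ?C" "\<And>J. J \<in> ?C \<Longrightarrow> N \<subseteq> J \<Longrightarrow> J = N"
        using exists_maximal_member[of ?C] by blast
      have "maximalideal N R"
      proof (rule maximalidealI)
        show "ideal N R" using N by simp
        show "carrier R \<noteq> N" using N by blast
        fix J assume J: "ideal J R" "N \<subseteq> J" "J \<subseteq> carrier R"
        show "J = N \<or> J = carrier R"
        proof (cases "\<one> \<in> J")
          case True
          then show ?thesis using ideal.one_imp_carrier[OF J(1)] by blast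
        next
          case False
          then have "J \<in> ?C" using J N(1) by blast
          then show ?thesis using N(2) J by blast
        qed
      qed
      then have "N = max_ideal R"
        using unique_maximalideal M.is_maximalideal by blast
      moreover have "x \<in> N" using N(1) cgenideal_self[OF x(1)] by blast
      ultimately show False using x by simp
    qed
  qed
qed

section \<open>Quadratic extensions that split as R + I t\<close>

lemma (in cring) prod_of_sums:
  assumes "x \<in> carrier R" "y \<in> carrier R" "z \<in> carrier R" "w \<in> carrier R" "d \<in> carrier R" "e \<in> carrier R"
    and yw: "y \<otimes> w = d \<oplus> e"
  shows "(x \<oplus> y) \<otimes> (z \<oplus> w) = (x \<otimes> z \<oplus> d) \<oplus> ((x \<otimes> w \<oplus> z \<otimes> y) \<oplus> e)"
proof -
  have "(x \<oplus> y) \<otimes> (z \<oplus> w) = (x \<otimes> z \<oplus> (x \<otimes> w \<oplus> z \<otimes> y)) \<oplus> y \<otimes> w"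
    using assms(1-6) by algebra
  also have "\<dots> = (x \<otimes> z \<oplus> d) \<oplus> ((x \<otimes> w \<oplus> z \<otimes> y) \<oplus> e)"
    unfolding yw using assms(1-6) by algebra
  finally show ?thesis .
qed

text \<open>The ring \<open>S\<close> with \<open>\<phi> r + \<psi> i\<close> in the role of \<open>r + i t\<close>. These properties determine \<open>S\<close> up to isomorphism, and
they are all that the comparison of \<open>S\<close> with \<open>R\<close> and \<open>I\<close> uses.\<close>

locale quadratic_extension = R: noetherian_local R \<mm> + S: cring S
  for R (structure) and \<mm> and S (structure) +
  fixes I a b \<phi> \<psi>
  assumes I_ideal: "ideal I R" and I_\<mm>: "I \<subseteq> \<mm>"
    and a_closed: "a \<in> carrier R" and b_closed: "b \<in> carrier R"
    and \<phi>_hom: "\<phi> \<in> ring_hom R S"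
    and \<psi>_closed: "i \<in> I \<Longrightarrow> \<psi> i \<in> carrier S"
    and \<psi>_add: "i \<in> I \<Longrightarrow> j \<in> I \<Longrightarrow> \<psi> (i \<oplus> j) = \<psi> i \<oplus>\<^bsub>S\<^esub> \<psi> j"
    and \<phi>_\<psi>: "r \<in> carrier R \<Longrightarrow> i \<in> I \<Longrightarrow> \<phi> r \<otimes>\<^bsub>S\<^esub> \<psi> i = \<psi> (r \<otimes> i)"
    and \<psi>_\<psi>: "i \<in> I \<Longrightarrow> j \<in> I \<Longrightarrow>
      \<psi> i \<otimes>\<^bsub>S\<^esub> \<psi> j = \<phi> (\<ominus> (b \<otimes> (i \<otimes> j))) \<oplus>\<^bsub>S\<^esub> \<psi> (\<ominus> (a \<otimes> (i \<otimes> j)))"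
    and decomposition: "s \<in> carrier S \<Longrightarrow> \<exists>r\<in>carrier R. \<exists>i\<in>I. s = \<phi> r \<oplus>\<^bsub>S\<^esub> \<psi> i"
    and independent: "r \<in> carrier R \<Longrightarrow> i \<in> I \<Longrightarrow> \<phi> r \<oplus>\<^bsub>S\<^esub> \<psi> i = \<zero>\<^bsub>S\<^esub> \<Longrightarrow> r = \<zero> \<and> i = \<zero>"
begin

sublocale h: ring_hom_cring R S \<phi>
  by (rule ring_hom_cring.intro[OF R.is_cring S.is_cring ring_hom_cring_axioms.intro[OF \<phi>_hom]])

lemmas I_closed [simp] = R.ideal_carrier[OF I_ideal]
lemmas I_zero [simp] = R.ideal_zero[OF I_ideal]
lemmas I_add [simp] = R.ideal_add[OF I_ideal]
lemmas I_diff [simp] = R.ideal_diff[OF I_ideal]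
lemmas I_mult [simp] = R.ideal_mult[OF I_ideal]
lemmas ab_closed [simp] = a_closed b_closed
declare \<psi>_closed [simp]

lemma I_neg [simp]: "i \<in> I \<Longrightarrow> \<ominus> i \<in> I"
  using I_mult[of "\<ominus> \<one>" i] by (simp add: R.l_minus)

lemma in_\<mm>: "i \<in> I \<Longrightarrow> i \<in> \<mm>"
  using I_\<mm> by blast

definition elt :: "'a \<Rightarrow> 'a \<Rightarrow> 'c"
  where "elt r i = \<phi> r \<oplus>\<^bsub>S\<^esub> \<psi> i"

lemma elt_closed [simp]: "r \<in> carrier R \<Longrightarrow> i \<in> I \<Longrightarrow> elt r i \<in> carrier S"
  by (simp add: elt_def)

lemma elt_cases:
  assumes "s \<in> carrier S"
  obtains r i where "r \<in> carrier R" "i \<in> I" "s = elt r i"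
  using decomposition[OF assms] by (auto simp: elt_def)

lemma \<psi>_zero [simp]: "\<psi> \<zero> = \<zero>\<^bsub>S\<^esub>"
  using \<phi>_\<psi>[of \<zero> \<zero>] by simp

lemma elt_zero_right [simp]: "r \<in> carrier R \<Longrightarrow> elt r \<zero> = \<phi> r"
  by (simp add: elt_def)

lemma elt_zero_left [simp]: "i \<in> I \<Longrightarrow> elt \<zero> i = \<psi> i"
  by (simp add: elt_def)

lemma elt_add:
  assumes [simp]: "r \<in> carrier R" "s \<in> carrier R" "i \<in> I" "j \<in> I"
  shows "elt r i \<oplus>\<^bsub>S\<^esub> elt s j = elt (r \<oplus> s) (i \<oplus> j)"
  by (simp add: elt_def \<psi>_add S.a_ac)

lemma elt_mult:
  assumes [simp]: "r \<in> carrier R" "s \<in> carrier R" "i \<in> I" "j \<in> I"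
  shows "elt r i \<otimes>\<^bsub>S\<^esub> elt s j =
    elt (r \<otimes> s \<ominus> b \<otimes> (i \<otimes> j)) ((r \<otimes> j \<oplus> s \<otimes> i) \<ominus> a \<otimes> (i \<otimes> j))"
proof -
  have "elt r i \<otimes>\<^bsub>S\<^esub> elt s j = (\<phi> r \<otimes>\<^bsub>S\<^esub> \<phi> s \<oplus>\<^bsub>S\<^esub> \<phi> (\<ominus> (b \<otimes> (i \<otimes> j)))) \<oplus>\<^bsub>S\<^esub>
    ((\<phi> r \<otimes>\<^bsub>S\<^esub> \<psi> j \<oplus>\<^bsub>S\<^esub> \<phi> s \<otimes>\<^bsub>S\<^esub> \<psi> i) \<oplus>\<^bsub>S\<^esub> \<psi> (\<ominus> (a \<otimes> (i \<otimes> j))))"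
    unfolding elt_def by (rule S.prod_of_sums[OF _ _ _ _ _ _ \<psi>_\<psi>]) simp_all
  also have "\<dots> = elt (r \<otimes> s \<ominus> b \<otimes> (i \<otimes> j)) ((r \<otimes> j \<oplus> s \<otimes> i) \<ominus> a \<otimes> (i \<otimes> j))"
    unfolding elt_def a_minus_def by (simp add: \<phi>_\<psi> \<psi>_add del: h.hom_a_inv)
  finally show ?thesis .
qed

lemma \<phi>_mult_elt:
  assumes [simp]: "z \<in> carrier R" "r \<in> carrier R" "i \<in> I"
  shows "\<phi> z \<otimes>\<^bsub>S\<^esub> elt r i = elt (z \<otimes> r) (z \<otimes> i)"
  by (simp add: elt_def S.r_distr \<phi>_\<psi>)

lemma elt_eq_iff:
  assumes [simp]: "r \<in> carrier R" "s \<in> carrier R" "i \<in> I" "j \<in> I"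
  shows "elt r i = elt s j \<longleftrightarrow> r = s \<and> i = j"
proof
  assume eq: "elt r i = elt s j"
  have "elt (r \<oplus> \<ominus> s) (i \<oplus> \<ominus> j) = elt r i \<oplus>\<^bsub>S\<^esub> elt (\<ominus> s) (\<ominus> j)"
    by (simp add: elt_add)
  also have "\<dots> = \<zero>\<^bsub>S\<^esub>"
    unfolding eq by (simp add: elt_add R.r_neg)
  finally have "r \<oplus> \<ominus> s = \<zero> \<and> i \<oplus> \<ominus> j = \<zero>"
    unfolding elt_def by (intro independent) auto
  then show "r = s \<and> i = j"
    using R.r_right_minus_eq[of r s] R.r_right_minus_eq[of i j] by (simp add: a_minus_def)
qed simp

text \<open>Trace, norm and conjugate of \<open>r + i t\<close> under \<open>t \<mapsto> - a - t\<close>, which exchanges the roots of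
\<open>t\<^sup>2 + a t + b\<close>.\<close>

definition trace :: "'a \<Rightarrow> 'a \<Rightarrow> 'a" where "trace r i = (r \<oplus> r) \<ominus> a \<otimes> i"
definition qnorm :: "'a \<Rightarrow> 'a \<Rightarrow> 'a" where "qnorm r i = r \<otimes> (r \<ominus> a \<otimes> i) \<oplus> b \<otimes> (i \<otimes> i)"
definition conjugate :: "'a \<Rightarrow> 'a \<Rightarrow> 'c" where "conjugate r i = elt (r \<ominus> a \<otimes> i) (\<ominus> i)"

lemma trace_qnorm_conjugate_closed [simp]:
  assumes "r \<in> carrier R" "i \<in> I"
  shows "trace r i \<in> carrier R" "qnorm r i \<in> carrier R" "conjugate r i \<in> carrier S"
  using assms by (auto simp: trace_def qnorm_def conjugate_def)

lemma elt_add_conjugate: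
  assumes [simp]: "r \<in> carrier R" "i \<in> I"
  shows "elt r i \<oplus>\<^bsub>S\<^esub> conjugate r i = \<phi> (trace r i)"
proof -
  have "r \<oplus> (r \<ominus> a \<otimes> i) = trace r i"
    unfolding trace_def using a_closed assms(1) I_closed[OF assms(2)] by algebra
  then show ?thesis by (simp add: conjugate_def elt_add R.r_neg)
qed

lemma elt_mult_conjugate:
  assumes [simp]: "r \<in> carrier R" "i \<in> I"
  shows "elt r i \<otimes>\<^bsub>S\<^esub> conjugate r i = \<phi> (qnorm r i)"
proof -
  note c = a_closed b_closed assms(1) I_closed[OF assms(2)]
  have "r \<otimes> (r \<ominus> a \<otimes> i) \<ominus> b \<otimes> (i \<otimes> (\<ominus> i)) = qnorm r i"
    unfolding qnorm_def using c by algebra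
  moreover have "(r \<otimes> (\<ominus> i) \<oplus> (r \<ominus> a \<otimes> i) \<otimes> i) \<ominus> a \<otimes> (i \<otimes> (\<ominus> i)) = \<zero>"
    using c by algebra
  moreover have "elt r i \<otimes>\<^bsub>S\<^esub> conjugate r i = elt (r \<otimes> (r \<ominus> a \<otimes> i) \<ominus> b \<otimes> (i \<otimes> (\<ominus> i)))
      ((r \<otimes> (\<ominus> i) \<oplus> (r \<ominus> a \<otimes> i) \<otimes> i) \<ominus> a \<otimes> (i \<otimes> (\<ominus> i)))"
    unfolding conjugate_def by (rule elt_mult) simp_all
  ultimately show ?thesis by (simp only: elt_zero_right trace_qnorm_conjugate_closed assms)
qed

text \<open>The set \<open>J + L t\<close>.\<close>

definition sum_ideal :: "'a set \<Rightarrow> 'a set \<Rightarrow> 'c set"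
  where "sum_ideal J L = {elt r i | r i. r \<in> J \<and> i \<in> L}"

lemma elt_in_sum_ideal:
  assumes "J \<subseteq> carrier R" "L \<subseteq> I" "r \<in> carrier R" "i \<in> I"
  shows "elt r i \<in> sum_ideal J L \<longleftrightarrow> r \<in> J \<and> i \<in> L"
  using assms unfolding sum_ideal_def by (auto simp: elt_eq_iff subset_iff)

text \<open>These are the ideals \<open>J + L t\<close> of \<open>S\<close>. The case \<open>J = \<mm>\<close>, \<open>L = I\<close> gives the maximal ideal; a prime \<open>J\<close> with
\<open>L = I \<inter> J\<close> gives an ideal that contracts to \<open>J\<close>.\<close>

lemma ideal_sum_ideal:
  assumes J: "ideal J R" and L: "ideal L R" "L \<subseteq> I" and JI: "\<And>r i. r \<in> J \<Longrightarrow> i \<in> I \<Longrightarrow> r \<otimes> i \<in> L"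
    and LJ: "L \<subseteq> J"
  shows "ideal (sum_ideal J L) S"
proof (rule S.idealI_cring)
  have Jc: "J \<subseteq> carrier R" using R.ideal_carrier[OF J] by blast
  note mem = elt_in_sum_ideal[OF Jc L(2)]
  show "sum_ideal J L \<subseteq> carrier S" using Jc L by (auto simp: sum_ideal_def subset_iff)
  show "\<zero>\<^bsub>S\<^esub> \<in> sum_ideal J L"
    using mem[of \<zero> \<zero>] R.ideal_zero[OF J] R.ideal_zero[OF L(1)] by simp
  fix x assume "x \<in> sum_ideal J L"
  then obtain r i where x: "x = elt r i" "r \<in> J" "i \<in> L" by (auto simp: sum_ideal_def)
  then have [simp]: "r \<in> carrier R" "i \<in> I" using Jc L by auto
  {
    fix y assume "y \<in> sum_ideal J L"
    then obtain s j where y: "y = elt s j" "s \<in> J" "j \<in> L" by (auto simp: sum_ideal_def)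
    then have [simp]: "s \<in> carrier R" "j \<in> I" using Jc L by auto
    show "x \<oplus>\<^bsub>S\<^esub> y \<in> sum_ideal J L"
      using x y R.ideal_add[OF J] R.ideal_add[OF L(1)] by (simp add: elt_add mem)
  next
    fix y assume "y \<in> carrier S"
    then obtain s j where y [simp]: "s \<in> carrier R" "j \<in> I" "y = elt s j" by (rule elt_cases)
    have "j \<otimes> i \<in> J" using R.ideal_mult[OF J, of j i] x LJ by auto
    then have "s \<otimes> r \<ominus> b \<otimes> (j \<otimes> i) \<in> J"
      using x R.ideal_diff[OF J] R.ideal_mult[OF J] by simp
    moreover have "s \<otimes> i \<in> L" "a \<otimes> (j \<otimes> i) \<in> L" "r \<otimes> j \<in> L"
      using x R.ideal_mult[OF L(1)] JI by simp_all
    then have "(s \<otimes> i \<oplus> r \<otimes> j) \<ominus> a \<otimes> (j \<otimes> i) \<in> L"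
      using R.ideal_diff[OF L(1)] R.ideal_add[OF L(1)] by simp
    ultimately show "y \<otimes>\<^bsub>S\<^esub> x \<in> sum_ideal J L"
      by (simp add: x(1) elt_mult mem)
  }
qed

definition \<nn> :: "'c set" where "\<nn> = sum_ideal \<mm> I"

lemma \<nn>_ideal: "ideal \<nn> S"
  unfolding \<nn>_def
  by (rule ideal_sum_ideal[OF R.\<mm>_ideal I_ideal]) (use I_\<mm> R.\<mm>_carrier in auto)

lemma elt_in_\<nn>: "r \<in> carrier R \<Longrightarrow> i \<in> I \<Longrightarrow> elt r i \<in> \<nn> \<longleftrightarrow> r \<in> \<mm>"
  unfolding \<nn>_def using elt_in_sum_ideal[of \<mm> I] R.\<mm>_carrier by auto

lemma \<mm>_prime:
  assumes "x \<in> carrier R" "y \<in> carrier R" "x \<otimes> y \<in> \<mm>" "x \<notin> \<mm>"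
  shows "y \<in> \<mm>"
proof -
  have x: "x \<in> Units R" using R.unit_outside assms by blast
  have "inv x \<otimes> (x \<otimes> y) \<in> \<mm>" using R.ideal_mult[OF R.\<mm>_ideal _ assms(3)] x by simp
  moreover have "inv x \<otimes> (x \<otimes> y) = y"
    using R.m_assoc[OF R.Units_inv_closed[OF x] R.Units_closed[OF x] assms(2)] R.Units_l_inv[OF x] assms(2)
    by simp
  ultimately show ?thesis by simp
qed

text \<open>The norm of \<open>r + i t\<close> is \<open>r\<^sup>2\<close> modulo \<open>I\<close>.\<close>

lemma qnorm_notin_\<mm>:
  assumes [simp]: "r \<in> carrier R" "i \<in> I" and r: "r \<notin> \<mm>"
  shows "qnorm r i \<notin> \<mm>"
proof
  assume qnorm: "qnorm r i \<in> \<mm>"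
  note c = a_closed b_closed assms(1) I_closed[OF assms(2)]
  have "i \<otimes> (a \<otimes> r \<ominus> b \<otimes> i) \<in> \<mm>"
    using R.ideal_mult_right[OF R.\<mm>_ideal] in_\<mm>[of i] by simp
  then have "qnorm r i \<oplus> i \<otimes> (a \<otimes> r \<ominus> b \<otimes> i) \<in> \<mm>" using R.ideal_add[OF R.\<mm>_ideal qnorm] by blast
  moreover have "qnorm r i \<oplus> i \<otimes> (a \<otimes> r \<ominus> b \<otimes> i) = r \<otimes> r"
    unfolding qnorm_def using c by algebra
  ultimately show False using \<mm>_prime[of r r] r by simp
qed

text \<open>The conjugate, divided by the norm, is an inverse.\<close>

lemma elt_unit:
  assumes [simp]: "r \<in> carrier R" "i \<in> I" and "r \<notin> \<mm>"
  shows "elt r i \<in> Units S"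
proof -
  let ?n = "qnorm r i"
  have n: "?n \<in> Units R" using R.unit_outside qnorm_notin_\<mm>[OF assms] by simp
  then have "elt r i \<otimes>\<^bsub>S\<^esub> (conjugate r i \<otimes>\<^bsub>S\<^esub> \<phi> (inv ?n)) = \<phi> ?n \<otimes>\<^bsub>S\<^esub> \<phi> (inv ?n)"
    by (simp add: S.m_assoc[symmetric] elt_mult_conjugate)
  also have "\<dots> = \<phi> (?n \<otimes> inv ?n)"
    by (rule h.hom_mult[symmetric]) (use n in simp_all)
  also have "\<dots> = \<one>\<^bsub>S\<^esub>" unfolding R.Units_r_inv[OF n] by simp
  finally have "elt r i \<otimes>\<^bsub>S\<^esub> (conjugate r i \<otimes>\<^bsub>S\<^esub> \<phi> (inv ?n)) = \<one>\<^bsub>S\<^esub>" .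
  moreover have "conjugate r i \<otimes>\<^bsub>S\<^esub> \<phi> (inv ?n) \<in> carrier S" using n by simp
  ultimately show ?thesis
    unfolding Units_def using S.m_comm[of "elt r i" "conjugate r i \<otimes>\<^bsub>S\<^esub> \<phi> (inv ?n)"] by auto
qed

text \<open>For an ideal \<open>Q\<close>, take generators of its contraction to \<open>R\<close>, and for generators of the ideal of coefficients
of \<open>t\<close> in \<open>Q\<close> take elements of \<open>Q\<close> with these coefficients.\<close>

lemma noetherian_ring_S: "noetherian_ring S"
proof (rule S.noetherian_ringI)
  fix Q assume Q: "ideal Q S"
  define Q0 where "Q0 = {r \<in> carrier R. \<phi> r \<in> Q}"
  have Q0: "ideal Q0 R" unfolding Q0_def
    by (rule R.idealI_cring)
      (use S.ideal_zero[OF Q] S.ideal_add[OF Q] S.ideal_mult[OF Q] in auto)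
  have lead: "ideal {i \<in> I. \<exists>r\<in>carrier R. elt r i \<in> G} R" if G: "ideal G S" for G
  proof (rule R.idealI_cring)
    show "{i \<in> I. \<exists>r\<in>carrier R. elt r i \<in> G} \<subseteq> carrier R" by auto
    show "\<zero> \<in> {i \<in> I. \<exists>r\<in>carrier R. elt r i \<in> G}"
      using S.ideal_zero[OF G] by (auto intro!: bexI[of _ \<zero>])
    fix i assume "i \<in> {i \<in> I. \<exists>r\<in>carrier R. elt r i \<in> G}"
    then obtain r where r: "r \<in> carrier R" "i \<in> I" "elt r i \<in> G" by auto
    {
      fix j assume "j \<in> {i \<in> I. \<exists>r\<in>carrier R. elt r i \<in> G}"
      then obtain s where s: "s \<in> carrier R" "j \<in> I" "elt s j \<in> G" by auto
      then have "elt (r \<oplus> s) (i \<oplus> j) \<in> G" using S.ideal_add[OF G r(3) s(3)] r by (simp add: elt_add)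
      then show "i \<oplus> j \<in> {i \<in> I. \<exists>r\<in>carrier R. elt r i \<in> G}" using r s by auto
    next
      fix t assume t: "t \<in> carrier R"
      then have "elt (t \<otimes> r) (t \<otimes> i) \<in> G" using S.ideal_mult[OF G _ r(3), of "\<phi> t"] r by (simp add: \<phi>_mult_elt)
      then show "t \<otimes> i \<in> {i \<in> I. \<exists>r\<in>carrier R. elt r i \<in> G}" using r t by auto
    }
  qed
  obtain A where A: "A \<subseteq> carrier R" "finite A" "Q0 = Idl A"
    using R.finetely_gen[OF Q0] by blast
  obtain B where B: "B \<subseteq> carrier R" "finite B" "{i \<in> I. \<exists>r\<in>carrier R. elt r i \<in> Q} = Idl B"
    using R.finetely_gen[OF lead[OF Q]] by blast
  have BI: "\<exists>r\<in>carrier R. elt r i \<in> Q" "i \<in> I" if "i \<in> B" for i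
    using that R.genideal_self[OF B(1)] B(3) by blast+
  have "\<forall>i\<in>B. \<exists>r. r \<in> carrier R \<and> elt r i \<in> Q" using BI(1) by blast
  from bchoice[OF this] obtain \<rho> where \<rho>: "\<And>i. i \<in> B \<Longrightarrow> \<rho> i \<in> carrier R \<and> elt (\<rho> i) i \<in> Q"
    by blast
  define gens where "gens = \<phi> ` A \<union> (\<lambda>i. elt (\<rho> i) i) ` B"
  have AQ: "\<phi> x \<in> Q" if "x \<in> A" for x
    using that R.genideal_self[OF A(1)] A(3) by (auto simp: Q0_def)
  have gens: "gens \<subseteq> carrier S" using A(1) \<rho> BI by (auto simp: gens_def)
  let ?G = "Idl\<^bsub>S\<^esub> gens"
  have G: "ideal ?G S" by (rule S.genideal_ideal[OF gens])
  have GQ: "?G \<subseteq> Q" by (rule S.genideal_minimal[OF Q]) (use AQ \<rho> in \<open>auto simp: gens_def\<close>)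
  have gensG: "gens \<subseteq> ?G" by (rule S.genideal_self[OF gens])
  have vim: "ideal {r \<in> carrier R. \<phi> r \<in> ?G} R"
    by (rule R.idealI_cring)
      (use S.ideal_zero[OF G] S.ideal_add[OF G] S.ideal_mult[OF G] in auto)
  have "Q0 \<subseteq> {r \<in> carrier R. \<phi> r \<in> ?G}"
    unfolding A(3) by (rule R.genideal_minimal[OF vim]) (use A(1) gensG in \<open>auto simp: gens_def\<close>)
  then have Q0G: "\<phi> r \<in> ?G" if "r \<in> Q0" for r using that by blast
  have "{i \<in> I. \<exists>r\<in>carrier R. elt r i \<in> Q} \<subseteq> {i \<in> I. \<exists>r\<in>carrier R. elt r i \<in> ?G}"
    unfolding B(3)
  proof (rule R.genideal_minimal[OF lead[OF G]])
    show "B \<subseteq> {i \<in> I. \<exists>r\<in>carrier R. elt r i \<in> ?G}"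
    proof
      fix i assume i: "i \<in> B"
      then have "elt (\<rho> i) i \<in> ?G" using gensG by (auto simp: gens_def)
      then show "i \<in> {i \<in> I. \<exists>r\<in>carrier R. elt r i \<in> ?G}" using \<rho>[OF i] BI(2)[OF i] by blast
    qed
  qed
  then have leadG: "\<exists>r\<in>carrier R. elt r i \<in> ?G" if "i \<in> I" "r \<in> carrier R" "elt r i \<in> Q" for r i
    using that by blast
  have "Q \<subseteq> ?G"
  proof
    fix x assume x: "x \<in> Q"
    obtain r i where ri: "r \<in> carrier R" "i \<in> I" "x = elt r i"
      using elt_cases[OF S.ideal_carrier[OF Q x]] .
    obtain s where s: "s \<in> carrier R" "elt s i \<in> ?G" using leadG[OF ri(2,1)] x ri(3) by blast
    have eq: "x = \<phi> (r \<ominus> s) \<oplus>\<^bsub>S\<^esub> elt s i"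
    proof -
      have "elt (r \<ominus> s) \<zero> \<oplus>\<^bsub>S\<^esub> elt s i = elt ((r \<ominus> s) \<oplus> s) (\<zero> \<oplus> i)"
        using ri s by (intro elt_add) auto
      moreover have "(r \<ominus> s) \<oplus> s = r" using ri(1) s(1) by algebra
      ultimately show ?thesis using ri s by simp
    qed
    have c: "\<phi> (r \<ominus> s) \<in> carrier S" "elt s i \<in> carrier S" using ri s by auto
    have "elt s i \<oplus>\<^bsub>S\<^esub> \<phi> (r \<ominus> s) \<in> Q" using x S.a_comm[OF c] eq by simp
    then have "\<phi> (r \<ominus> s) \<in> Q" using S.ideal_add_cancel[OF Q _ c(1)] s(2) GQ by blast
    then have "r \<ominus> s \<in> Q0" unfolding Q0_def mem_Collect_eq using R.minus_closed ri(1) s(1) by blast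
    then have "\<phi> (r \<ominus> s) \<in> ?G" by (rule Q0G)
    then show "x \<in> ?G" unfolding eq using S.ideal_add[OF G] s(2) by blast
  qed
  then show "\<exists>A\<subseteq>carrier S. finite A \<and> Q = Idl\<^bsub>S\<^esub> A"
    using GQ gens A(2) B(2) by (intro exI[of _ gens]) (auto simp: gens_def)
qed

lemma noetherian_local_S: "noetherian_local S \<nn>"
proof (intro noetherian_local.intro noetherian_local_axioms.intro noetherian_cring.intro
    S.is_cring noetherian_ring_S \<nn>_ideal)
  show "\<one>\<^bsub>S\<^esub> \<notin> \<nn>" using elt_in_\<nn>[of \<one> \<zero>] R.one_notin by simp
  fix x assume "x \<in> carrier S" "x \<notin> \<nn>"
  then show "x \<in> Units S" using elt_cases[of x] elt_unit elt_in_\<nn> by metis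
qed

sublocale S: noetherian_local S \<nn>
  by (rule noetherian_local_S)

lemma prime_contraction:
  assumes "primeideal P S"
  shows "primeideal {r \<in> carrier R. \<phi> r \<in> P} R"
  by (rule h.prime_vimage[OF assms])

text \<open>A prime \<open>P\<close> of \<open>S\<close> that contains the image of \<open>\<mm>\<close> contains \<open>(i t)\<^sup>2 = - b i\<^sup>2 - a i (i t)\<close> for \<open>i \<in> I\<close>, hence
\<open>i t\<close>, and so equals \<open>\<nn>\<close>. For all other primes, prime avoidance can be applied to their contractions to \<open>R\<close>.\<close>

lemma generic_set_image: "generic_set S \<nn> (\<phi> ` \<mm>)"
  unfolding generic_set_def
proof (intro conjI allI impI)
  show "\<phi> ` \<mm> \<subseteq> \<nn>" using elt_in_\<nn>[of _ \<zero>] R.\<mm>_carrier by auto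
  fix F assume F: "finite F" "\<forall>P\<in>F. primeideal P S \<and> P \<noteq> \<nn>"
  let ?c = "\<lambda>P. {r \<in> carrier R. \<phi> r \<in> P}"
  have ne: "?c P \<noteq> \<mm>" if P: "P \<in> F" for P
  proof
    assume eq: "?c P = \<mm>"
    interpret P: primeideal P S using F P by blast
    have \<mm>P: "\<phi> r \<in> P" if "r \<in> \<mm>" for r using that eq by blast
    have "\<nn> \<subseteq> P"
    proof
      fix x assume "x \<in> \<nn>"
      then obtain r i where x: "x = elt r i" "r \<in> \<mm>" "i \<in> I" by (auto simp: \<nn>_def sum_ideal_def)
      have "\<psi> i \<otimes>\<^bsub>S\<^esub> \<psi> i = \<phi> (\<ominus> (b \<otimes> (i \<otimes> i))) \<oplus>\<^bsub>S\<^esub> \<phi> (\<ominus> (a \<otimes> i)) \<otimes>\<^bsub>S\<^esub> \<psi> i"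
        using \<psi>_\<psi>[OF x(3,3)] \<phi>_\<psi>[of "\<ominus> (a \<otimes> i)" i] x(3) by (simp add: R.l_minus R.m_assoc del: h.hom_a_inv)
      moreover have "\<phi> (\<ominus> (b \<otimes> (i \<otimes> i))) \<in> P" "\<phi> (\<ominus> (a \<otimes> i)) \<in> P"
        using x(3) by (auto intro!: \<mm>P in_\<mm> simp del: h.hom_a_inv)
      ultimately have "\<psi> i \<otimes>\<^bsub>S\<^esub> \<psi> i \<in> P"
        using S.ideal_add[OF P.is_ideal] S.ideal_mult_right[OF P.is_ideal] x(3) by simp
      then have "\<psi> i \<in> P" using P.I_prime[of "\<psi> i" "\<psi> i"] x(3) by auto
      then show "x \<in> P" unfolding x elt_def using S.ideal_add[OF P.is_ideal] \<mm>P[OF x(2)] by blast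
    qed
    moreover have "P \<subseteq> \<nn>"
      using S.proper_ideal_subset[OF P.is_ideal] P.one_imp_carrier P.I_notcarr by blast
    ultimately show False using F P by blast
  qed
  have "finite (?c ` F)" "\<forall>P\<in>?c ` F. primeideal P R \<and> P \<noteq> \<mm>"
    using F prime_contraction ne by auto
  then obtain z where z: "z \<in> \<mm>" "\<forall>P\<in>?c ` F. z \<notin> P"
    using R.generic_set_\<mm> unfolding generic_set_def by meson
  then show "\<exists>z\<in>\<phi> ` \<mm>. \<forall>P\<in>F. z \<notin> P" using R.\<mm>_carrier by auto
qed

lemma add_multiples_sum_ideal:
  assumes z: "z \<in> carrier R" and J: "J \<subseteq> carrier R" and L: "L \<subseteq> I"
  shows "add_multiples S (carrier S) (sum_ideal J L) (\<phi> z) =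
    sum_ideal (add_multiples R (carrier R) J z) (add_multiples R I L z)"
proof (intro equalityI subsetI)
  fix x assume "x \<in> add_multiples S (carrier S) (sum_ideal J L) (\<phi> z)"
  then obtain u v where u: "u \<in> sum_ideal J L" and v: "v \<in> carrier S" and x: "x = u \<oplus>\<^bsub>S\<^esub> \<phi> z \<otimes>\<^bsub>S\<^esub> v"
    by (auto simp: add_multiples_def)
  obtain r i where ri: "u = elt r i" "r \<in> J" "i \<in> L" using u by (auto simp: sum_ideal_def)
  obtain s j where sj: "s \<in> carrier R" "j \<in> I" "v = elt s j" using elt_cases[OF v] .
  have "x = elt (r \<oplus> z \<otimes> s) (i \<oplus> z \<otimes> j)"
    using ri sj z J L by (auto simp: x \<phi>_mult_elt elt_add subset_iff)
  then show "x \<in> sum_ideal (add_multiples R (carrier R) J z) (add_multiples R I L z)"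
    unfolding sum_ideal_def add_multiples_def using ri sj by blast
next
  fix x assume "x \<in> sum_ideal (add_multiples R (carrier R) J z) (add_multiples R I L z)"
  then obtain r s i j where x: "x = elt (r \<oplus> z \<otimes> s) (i \<oplus> z \<otimes> j)" "r \<in> J" "s \<in> carrier R" "i \<in> L" "j \<in> I"
    unfolding sum_ideal_def add_multiples_def by blast
  then have "x = elt r i \<oplus>\<^bsub>S\<^esub> \<phi> z \<otimes>\<^bsub>S\<^esub> elt s j"
    using z J L by (auto simp: \<phi>_mult_elt elt_add subset_iff)
  moreover have "elt r i \<in> sum_ideal J L" using x by (auto simp: sum_ideal_def)
  ultimately show "x \<in> add_multiples S (carrier S) (sum_ideal J L) (\<phi> z)"
    using x by (intro add_multiplesI) auto
qed

lemma regular_mod_sum_ideal: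
  assumes z: "z \<in> carrier R" and J: "ideal J R" and L: "ideal L R" "L \<subseteq> I"
  shows "regular_mod S (carrier S) (sum_ideal J L) (\<phi> z) \<longleftrightarrow>
    regular_mod R (carrier R) J z \<and> regular_mod R I L z"
proof -
  have Jc: "J \<subseteq> carrier R" using R.ideal_carrier[OF J] by blast
  note mem = elt_in_sum_ideal[OF Jc L(2)]
  have *: "\<phi> z \<otimes>\<^bsub>S\<^esub> elt r i \<in> sum_ideal J L \<longleftrightarrow> z \<otimes> r \<in> J \<and> z \<otimes> i \<in> L"
    if "r \<in> carrier R" "i \<in> I" for r i
    using that z by (simp add: \<phi>_mult_elt mem)
  have "regular_mod S (carrier S) (sum_ideal J L) (\<phi> z) \<longleftrightarrow>
    (\<forall>r\<in>carrier R. \<forall>i\<in>I. z \<otimes> r \<in> J \<and> z \<otimes> i \<in> L \<longrightarrow> r \<in> J \<and> i \<in> L)"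
    unfolding regular_mod_def using elt_cases elt_closed * mem by metis
  also have "\<dots> \<longleftrightarrow> regular_mod R (carrier R) J z \<and> regular_mod R I L z"
  proof (intro iffI conjI)
    assume A: "\<forall>r\<in>carrier R. \<forall>i\<in>I. z \<otimes> r \<in> J \<and> z \<otimes> i \<in> L \<longrightarrow> r \<in> J \<and> i \<in> L"
    have 0: "z \<otimes> \<zero> \<in> J" "z \<otimes> \<zero> \<in> L" using z R.ideal_zero[OF J] R.ideal_zero[OF L(1)] by auto
    show "regular_mod R (carrier R) J z" unfolding regular_mod_def using A 0 I_zero by blast
    show "regular_mod R I L z" unfolding regular_mod_def using A 0 R.zero_closed by blast
  qed (auto simp: regular_mod_def)
  finally show ?thesis .
qed

text \<open>Regularity on \<open>S = R \<oplus> I\<close> of elements of \<open>R\<close> can be tested on the two summands.\<close>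

lemma weakly_regular_sum_ideal:
  assumes "set zs \<subseteq> carrier R" "ideal J R" "ideal L R" "L \<subseteq> I"
  shows "weakly_regular S (carrier S) (sum_ideal J L) (map \<phi> zs) \<longleftrightarrow>
    weakly_regular R (carrier R) J zs \<and> weakly_regular R I L zs"
  using assms
proof (induction zs arbitrary: J L)
  case (Cons z zs)
  have z: "z \<in> carrier R" using Cons.prems by simp
  have J: "J \<subseteq> carrier R" using R.ideal_carrier[OF Cons.prems(2)] by blast
  show ?case
    using Cons.IH[OF _ R.add_multiples_ideal[OF R.oneideal Cons.prems(2) z]
        R.add_multiples_ideal[OF I_ideal Cons.prems(3) z]
        R.add_multiples_subset[OF I_ideal Cons.prems(3) z Cons.prems(4)]] Cons.prems(1)
      regular_mod_sum_ideal[OF z Cons.prems(2-4)] add_multiples_sum_ideal[OF z J Cons.prems(4)]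
    by auto
qed simp

text \<open>Lying over (for \<open>Q = 0\<close>) and going up. The ideal \<open>Q + (P + (I \<inter> P) t)\<close> does not meet the image of the
complement of \<open>P\<close>, so a prime that contains it and is disjoint from this image contracts to \<open>P\<close>. Indeed, if
\<open>r = q + e\<close> with \<open>e = p + j t\<close>, then \<open>e\<close> satisfies a monic quadratic equation whose other coefficients, up to sign
its trace and its norm, lie in \<open>P\<close>. Modulo \<open>Q\<close> also \<open>r\<close> satisfies it, whence \<open>r\<^sup>2 \<in> P\<close>.\<close>

lemma prime_extension:
  assumes P: "primeideal P R" and Q: "ideal Q S" and QP: "\<And>r. r \<in> carrier R \<Longrightarrow> \<phi> r \<in> Q \<Longrightarrow> r \<in> P"
  obtains Q' where "primeideal Q' S" "Q \<subseteq> Q'" "{r \<in> carrier R. \<phi> r \<in> Q'} = P"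
proof -
  interpret P: primeideal P R by fact
  note Pid = P.is_ideal
  let ?E = "sum_ideal P (I \<inter> P)"
  have IP: "ideal (I \<inter> P) R" by (rule R.i_intersect[OF I_ideal Pid])
  have E: "ideal ?E S"
    by (rule ideal_sum_ideal[OF Pid IP])
      (use R.ideal_mult_right[OF Pid] R.ideal_carrier[OF Pid] in auto)
  have QE: "ideal (Q <+>\<^bsub>S\<^esub> ?E) S" by (rule S.add_ideals[OF Q E])
  have disj: "(Q <+>\<^bsub>S\<^esub> ?E) \<inter> \<phi> ` (carrier R - P) = {}"
  proof (rule ccontr)
    assume "\<not> ?thesis"
    then obtain x where x: "x \<in> Q <+>\<^bsub>S\<^esub> ?E" "x \<in> \<phi> ` (carrier R - P)" by blast
    from x(2) obtain r where r: "r \<in> carrier R" "r \<notin> P" "x = \<phi> r" by blast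
    from x(1) obtain q e where q: "q \<in> Q" and e: "e \<in> ?E" and "x = q \<oplus>\<^bsub>S\<^esub> e"
      unfolding set_add_def' by blast
    with r(3) have eq: "\<phi> r = q \<oplus>\<^bsub>S\<^esub> e" by simp
    obtain p j where pj: "e = elt p j" "p \<in> P" "j \<in> I" "j \<in> P" using e by (auto simp: sum_ideal_def)
    have c [simp]: "p \<in> carrier R" "q \<in> carrier S" "e \<in> carrier S" "j \<in> carrier R"
      using R.ideal_carrier[OF Pid pj(2)] S.ideal_carrier[OF Q q] S.ideal_carrier[OF E e] pj(3) by auto
    define f where "f = conjugate p j"
    have f [simp]: "f \<in> carrier S" by (simp add: f_def pj(3))
    have trace: "trace p j \<in> P" unfolding trace_def
      using pj R.ideal_add[OF Pid] R.ideal_mult[OF Pid] R.ideal_diff[OF Pid] by simp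
    have qnorm: "qnorm p j \<in> P" unfolding qnorm_def
      using pj R.ideal_add[OF Pid] R.ideal_mult[OF Pid] R.ideal_mult_right[OF Pid] R.ideal_diff[OF Pid]
      by simp
    \<comment> \<open>the quadratic polynomial of \<open>e\<close> at \<open>r = q + e\<close> is \<open>(r - e) (r - f)\<close>, a multiple of \<open>q\<close>\<close>
    have "q \<otimes>\<^bsub>S\<^esub> ((q \<oplus>\<^bsub>S\<^esub> e) \<ominus>\<^bsub>S\<^esub> f) =
      ((q \<oplus>\<^bsub>S\<^esub> e) \<otimes>\<^bsub>S\<^esub> (q \<oplus>\<^bsub>S\<^esub> e) \<ominus>\<^bsub>S\<^esub> (q \<oplus>\<^bsub>S\<^esub> e) \<otimes>\<^bsub>S\<^esub> (e \<oplus>\<^bsub>S\<^esub> f)) \<oplus>\<^bsub>S\<^esub> e \<otimes>\<^bsub>S\<^esub> f"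
      using c(2,3) f by algebra
    also have "\<dots> = \<phi> ((r \<otimes> r \<ominus> r \<otimes> trace p j) \<oplus> qnorm p j)"
      unfolding eq[symmetric] using elt_add_conjugate[of p j] elt_mult_conjugate[of p j] pj r
      by (simp add: f_def a_minus_def)
    finally have inQ: "\<phi> ((r \<otimes> r \<ominus> r \<otimes> trace p j) \<oplus> qnorm p j) \<in> Q"
      using S.ideal_mult_right[OF Q _ q, of "(q \<oplus>\<^bsub>S\<^esub> e) \<ominus>\<^bsub>S\<^esub> f"] by simp
    have tn [simp]: "trace p j \<in> carrier R" "qnorm p j \<in> carrier R" using pj by auto
    have "(r \<otimes> r \<ominus> r \<otimes> trace p j) \<oplus> qnorm p j \<in> P" by (rule QP[OF _ inQ]) (use r(1) in simp)
    moreover have "(r \<otimes> trace p j \<ominus> qnorm p j) \<oplus> ((r \<otimes> r \<ominus> r \<otimes> trace p j) \<oplus> qnorm p j) = r \<otimes> r"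
      using r(1) tn by algebra
    moreover have "r \<otimes> trace p j \<ominus> qnorm p j \<in> P"
      using R.ideal_diff[OF Pid] R.ideal_mult[OF Pid r(1) trace] qnorm by blast
    ultimately have "r \<otimes> r \<in> P" using R.ideal_add[OF Pid] by fastforce
    then show False using P.I_prime[of r r] r by blast
  qed
  have one: "\<one>\<^bsub>S\<^esub> \<in> \<phi> ` (carrier R - P)"
    using P.I_notcarr P.one_imp_carrier by (intro image_eqI[of _ _ \<one>]) auto
  have mult: "s \<otimes>\<^bsub>S\<^esub> t \<in> \<phi> ` (carrier R - P)" if st: "s \<in> \<phi> ` (carrier R - P)" "t \<in> \<phi> ` (carrier R - P)" for s t
  proof -
    obtain u v where uv: "u \<in> carrier R - P" "v \<in> carrier R - P" "s = \<phi> u" "t = \<phi> v"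
      using st by blast
    then have "s \<otimes>\<^bsub>S\<^esub> t = \<phi> (u \<otimes> v)" "u \<otimes> v \<in> carrier R - P" using P.I_prime[of u v] by auto
    then show ?thesis by blast
  qed
  obtain Q' where Q': "primeideal Q' S" "Q <+>\<^bsub>S\<^esub> ?E \<subseteq> Q'" "Q' \<inter> \<phi> ` (carrier R - P) = {}"
    by (rule S.exists_prime_disjoint[OF QE one mult disj])
  have "Q \<subseteq> Q <+>\<^bsub>S\<^esub> ?E"
  proof
    fix q assume q: "q \<in> Q"
    have "q = q \<oplus>\<^bsub>S\<^esub> \<zero>\<^bsub>S\<^esub>" using S.ideal_carrier[OF Q q] by simp
    then show "q \<in> Q <+>\<^bsub>S\<^esub> ?E" unfolding set_add_def' using q S.ideal_zero[OF E] by blast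
  qed
  moreover have "\<phi> p \<in> Q <+>\<^bsub>S\<^esub> ?E" if p: "p \<in> P" for p
  proof -
    have pc: "p \<in> carrier R" using R.ideal_carrier[OF Pid p] .
    have "elt p \<zero> \<in> ?E"
      unfolding sum_ideal_def using p R.ideal_zero[OF Pid]
      by (intro CollectI exI[of _ p] exI[of _ \<zero>]) auto
    moreover have "\<phi> p = \<zero>\<^bsub>S\<^esub> \<oplus>\<^bsub>S\<^esub> elt p \<zero>" using pc by simp
    ultimately show ?thesis unfolding set_add_def' using S.ideal_zero[OF Q] by blast
  qed
  ultimately show ?thesis using that[OF Q'(1)] Q'(2,3) R.ideal_carrier[OF Pid] by blast
qed

text \<open>Incomparability. Suppose that \<open>Q\<close> and \<open>Q'\<close> have the same contraction, and let \<open>s \<in> Q'\<close>. The norm of \<open>s\<close> lies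
in \<open>Q'\<close>, hence in \<open>Q\<close>, so \<open>s\<close> or its conjugate lies in \<open>Q\<close>. In the latter case the trace of \<open>s\<close> is in \<open>Q'\<close>, hence
in \<open>Q\<close>, and again \<open>s \<in> Q\<close>.\<close>

lemma prime_contraction_strict:
  assumes Q: "primeideal Q S" and Q': "primeideal Q' S" and sub: "Q \<subset> Q'"
  shows "{r \<in> carrier R. \<phi> r \<in> Q} \<subset> {r \<in> carrier R. \<phi> r \<in> Q'}"
proof (rule ccontr)
  assume "\<not> ?thesis"
  then have eq: "\<phi> r \<in> Q" if "r \<in> carrier R" "\<phi> r \<in> Q'" for r using sub that by blast
  interpret Q: primeideal Q S by fact
  interpret Q': primeideal Q' S by fact
  obtain s where s: "s \<in> Q'" "s \<notin> Q" using sub by blast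
  have sc: "s \<in> carrier S" using S.ideal_carrier[OF Q'.is_ideal s(1)] .
  obtain r i where ri: "r \<in> carrier R" "i \<in> I" "s = elt r i" using elt_cases[OF sc] .
  have c: "conjugate r i \<in> carrier S" using ri by simp
  have "\<phi> (qnorm r i) \<in> Q'"
    using S.ideal_mult_right[OF Q'.is_ideal c s(1)] elt_mult_conjugate[OF ri(1,2)] ri(3) by simp
  then have "s \<otimes>\<^bsub>S\<^esub> conjugate r i \<in> Q" using eq ri elt_mult_conjugate[OF ri(1,2)] by simp
  then have cQ: "conjugate r i \<in> Q" using Q.I_prime[OF sc c] s(2) by blast
  then have "conjugate r i \<in> Q'" using sub by blast
  then have "\<phi> (trace r i) \<in> Q'"
    using S.ideal_add[OF Q'.is_ideal s(1)] elt_add_conjugate[OF ri(1,2)] ri(3) by metis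
  then have "s \<oplus>\<^bsub>S\<^esub> conjugate r i \<in> Q" using eq ri elt_add_conjugate[OF ri(1,2)] by simp
  then have "conjugate r i \<oplus>\<^bsub>S\<^esub> s \<in> Q" using S.a_comm[OF sc c] by simp
  then show False using S.ideal_add_cancel[OF Q.is_ideal cQ sc] s(2) by blast
qed

lemma lift_prime_chain:
  assumes "prime_chain R n P"
  shows "\<exists>Q. prime_chain S n Q \<and> {r \<in> carrier R. \<phi> r \<in> Q n} = P n"
  using assms
proof (induction n)
  case 0
  have "primeideal (P 0) R" using 0 by (simp add: prime_chain_def)
  moreover have "r \<in> P 0" if "r \<in> carrier R" "\<phi> r \<in> {\<zero>\<^bsub>S\<^esub>}" for r
  proof -
    have "r = \<zero>" using independent[of r \<zero>] that by simp
    then show ?thesis using \<open>primeideal (P 0) R\<close> R.ideal_zero primeideal_def by blast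
  qed
  ultimately obtain Q where "primeideal Q S" "{r \<in> carrier R. \<phi> r \<in> Q} = P 0"
    using prime_extension[OF _ S.zeroideal] by metis
  then show ?case by (intro exI[of _ "\<lambda>_. Q"]) (simp add: prime_chain_def)
next
  case (Suc n)
  then have "prime_chain R n P" by (simp add: prime_chain_def)
  then obtain Q where Q: "prime_chain S n Q" "{r \<in> carrier R. \<phi> r \<in> Q n} = P n" using Suc.IH by blast
  have P: "primeideal (P (Suc n)) R" "P n \<subset> P (Suc n)" using Suc.prems by (auto simp: prime_chain_def)
  have idQ: "ideal (Q n) S" using Q(1) by (simp add: prime_chain_def primeideal_def)
  have QP: "r \<in> P (Suc n)" if "r \<in> carrier R" "\<phi> r \<in> Q n" for r using that Q(2) P(2) by blast
  obtain Q' where Q': "primeideal Q' S" "Q n \<subseteq> Q'" "{r \<in> carrier R. \<phi> r \<in> Q'} = P (Suc n)"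
    by (rule prime_extension[OF P(1) idQ QP])
  then have "Q n \<subset> Q'" using Q(2) P(2) by auto
  then have "prime_chain S (Suc n) (Q(Suc n := Q'))"
    using Q(1) Q'(1) by (auto simp: prime_chain_def le_Suc_eq less_Suc_eq)
  with Q'(3) have "prime_chain S (Suc n) (Q(Suc n := Q')) \<and>
      {r \<in> carrier R. \<phi> r \<in> (Q(Suc n := Q')) (Suc n)} = P (Suc n)"
    by (simp only: fun_upd_same simp_thms)
  then show ?case by (rule exI[where x = "Q(Suc n := Q')"])
qed

lemma krull_dim_S: "krull_dim S = krull_dim R"
proof (rule antisym)
  show "krull_dim R \<le> krull_dim S"
  proof (rule krull_dim_leI)
    fix n P assume "prime_chain R n P"
    from lift_prime_chain[OF this] show "enat n \<le> krull_dim S"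
      by (elim exE conjE) (rule prime_chain_le_krull_dim)
  qed
  show "krull_dim S \<le> krull_dim R"
  proof (rule krull_dim_leI)
    fix n Q assume "prime_chain S n Q"
    then have "prime_chain R n (\<lambda>i. {r \<in> carrier R. \<phi> r \<in> Q i})"
      using prime_contraction prime_contraction_strict by (simp add: prime_chain_def)
    then show "enat n \<le> krull_dim R" by (rule prime_chain_le_krull_dim)
  qed
qed

text \<open>Both directions use \<open>exists_common_regular_sequence\<close>: over \<open>S\<close> to move a regular sequence into the image
of \<open>\<mm>\<close>, and over \<open>R\<close> to find one that serves \<open>R\<close> and \<open>I\<close> at the same time.\<close>

theorem cohen_macaulay_S_iff:
  assumes CM: "cohen_macaulay_local_ring R" and d: "krull_dim R = enat d"
  shows "cohen_macaulay_local_ring S \<longleftrightarrow>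
    (\<exists>zs. length zs = d \<and> set zs \<subseteq> \<mm> \<and> weakly_regular R I {\<zero>} zs)"
proof -
  have nzR: "carrier R \<noteq> {\<zero>}" using R.one_notin R.ideal_zero[OF R.\<mm>_ideal] R.one_closed
    by (metis singletonD)
  have nzS: "carrier S \<noteq> {\<zero>\<^bsub>S\<^esub>}" using S.one_notin S.ideal_zero[OF \<nn>_ideal] S.one_closed
    by (metis singletonD)
  have "enat d \<le> depth R (ideal_module R (carrier R))"
    using CM d by (simp add: cohen_macaulay_local_ring_def R.self_module_eq[symmetric])
  then obtain xs where xs: "length xs = d" "set xs \<subseteq> \<mm>" "weakly_regular R (carrier R) {\<zero>} xs"
    using R.depth_ge_iff[OF R.oneideal nzR, of d] by blast
  have "cohen_macaulay_local_ring S \<longleftrightarrow> enat d \<le> depth S (ideal_module S (carrier S))"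
    using S.local_ring noetherian_ring_S S.depth_le_krull_dim(2)[OF S.oneideal]
    by (auto simp: cohen_macaulay_local_ring_def S.self_module_eq[symmetric] krull_dim_S d)
  also have "\<dots> \<longleftrightarrow> (\<exists>ss. length ss = d \<and> set ss \<subseteq> \<nn> \<and> weakly_regular S (carrier S) {\<zero>\<^bsub>S\<^esub>} ss)"
    by (rule S.depth_ge_iff[OF S.oneideal nzS])
  also have "\<dots> \<longleftrightarrow> (\<exists>zs. length zs = d \<and> set zs \<subseteq> \<mm> \<and>
      weakly_regular R (carrier R) {\<zero>} zs \<and> weakly_regular R I {\<zero>} zs)"
  proof -
    have "sum_ideal {\<zero>} {\<zero>} = {\<zero>\<^bsub>S\<^esub>}" by (auto simp: sum_ideal_def)
    then have transfer: "weakly_regular S (carrier S) {\<zero>\<^bsub>S\<^esub>} (map \<phi> zs) \<longleftrightarrow>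
      weakly_regular R (carrier R) {\<zero>} zs \<and> weakly_regular R I {\<zero>} zs" if "set zs \<subseteq> \<mm>" for zs
      using weakly_regular_sum_ideal[OF _ R.zeroideal R.zeroideal, of zs] that R.\<mm>_carrier by auto
    show ?thesis
    proof
      assume "\<exists>ss. length ss = d \<and> set ss \<subseteq> \<nn> \<and> weakly_regular S (carrier S) {\<zero>\<^bsub>S\<^esub>} ss"
      then obtain ss where ss: "length ss = d" "set ss \<subseteq> \<nn>" "weakly_regular S (carrier S) {\<zero>\<^bsub>S\<^esub>} ss" by blast
      obtain ts where ts: "length ts = d" "set ts \<subseteq> \<phi> ` \<mm>" "weakly_regular S (carrier S) {\<zero>\<^bsub>S\<^esub>} ts"
        using S.exists_common_regular_sequence[OF generic_set_image S.oneideal S.oneideal S.zeroideal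
            S.zeroideal ss ss] by blast
      define zs where "zs = map (inv_into \<mm> \<phi>) ts"
      have "map \<phi> zs = ts"
        using ts(2) by (auto simp: zs_def f_inv_into_f subset_iff intro!: map_idI)
      moreover have "set zs \<subseteq> \<mm>" using ts(2) by (auto simp: zs_def intro!: inv_into_into)
      ultimately have "length zs = d \<and> set zs \<subseteq> \<mm> \<and>
          weakly_regular R (carrier R) {\<zero>} zs \<and> weakly_regular R I {\<zero>} zs"
        using ts(1,3) transfer[of zs] by (simp add: zs_def)
      then show "\<exists>zs. length zs = d \<and> set zs \<subseteq> \<mm> \<and>
          weakly_regular R (carrier R) {\<zero>} zs \<and> weakly_regular R I {\<zero>} zs"
        by blast
    next
      assume "\<exists>zs. length zs = d \<and> set zs \<subseteq> \<mm> \<and>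
          weakly_regular R (carrier R) {\<zero>} zs \<and> weakly_regular R I {\<zero>} zs"
      then obtain zs where zs: "length zs = d" "set zs \<subseteq> \<mm>"
        "weakly_regular R (carrier R) {\<zero>} zs" "weakly_regular R I {\<zero>} zs" by blast
      moreover have "set (map \<phi> zs) \<subseteq> \<nn>" using zs(2) generic_set_image by (auto simp: generic_set_def)
      ultimately show "\<exists>ss. length ss = d \<and> set ss \<subseteq> \<nn> \<and> weakly_regular S (carrier S) {\<zero>\<^bsub>S\<^esub>} ss"
        using transfer by (intro exI[of _ "map \<phi> zs"]) auto
    qed
  qed
  also have "\<dots> \<longleftrightarrow> (\<exists>zs. length zs = d \<and> set zs \<subseteq> \<mm> \<and> weakly_regular R I {\<zero>} zs)"
  proof
    assume "\<exists>zs. length zs = d \<and> set zs \<subseteq> \<mm> \<and> weakly_regular R I {\<zero>} zs"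
    then obtain ys where ys: "length ys = d" "set ys \<subseteq> \<mm>" "weakly_regular R I {\<zero>} ys" by blast
    show "\<exists>zs. length zs = d \<and> set zs \<subseteq> \<mm> \<and>
          weakly_regular R (carrier R) {\<zero>} zs \<and> weakly_regular R I {\<zero>} zs"
      by (rule R.exists_common_regular_sequence[OF R.generic_set_\<mm> R.oneideal I_ideal R.zeroideal
            R.zeroideal xs ys])
  qed blast
  finally show ?thesis .
qed

end

section \<open>The Rees algebra modulo a monic quadratic polynomial\<close>

lemma (in cring) ideal_finsum_atMost:
  fixes n :: nat
  assumes K: "ideal K R" and f: "\<And>i. i \<le> n \<Longrightarrow> f i \<in> K"
  shows "(\<Oplus>i\<in>{..n}. f i) \<in> K"
  using f
proof (induction n)
  case 0
  then show ?case using ideal_carrier[OF K] by simp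
next
  case (Suc n)
  have "f \<in> {..Suc n} \<rightarrow> carrier R" using Suc.prems ideal_carrier[OF K] by auto
  then have "(\<Oplus>i\<in>{..Suc n}. f i) = f (Suc n) \<oplus> (\<Oplus>i\<in>{..n}. f i)" by (rule finsum_Suc)
  then show ?case using Suc.IH Suc.prems ideal_add[OF K] by simp
qed

locale rees_setup = cring +
  fixes I a b
  assumes I: "ideal I R" and a: "a \<in> carrier R" and b: "b \<in> carrier R"
begin

sublocale UP: UP_cring R "UP R"
  by (intro UP_cring.intro is_cring) simp

abbreviation "P \<equiv> UP R"
abbreviation "cf \<equiv> coeff (UP R)"
definition Ipow :: "nat \<Rightarrow> 'a set" where "Ipow n = I [^]\<^bsub>ideals_set R\<^esub> n"
abbreviation "A \<equiv> rees_algebra R I"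
abbreviation "f \<equiv> quadratic_poly R a b"

lemma I_powers: "comm_monoid (ideals_set R)" "I \<in> carrier (ideals_set R)"
  using ideals_set_is_comm_monoid I by (auto simp: ideals_set_def)

lemma Ipow_ideal: "ideal (Ipow n) R"
proof -
  interpret M: comm_monoid "ideals_set R" by (rule I_powers)
  show ?thesis using M.nat_pow_closed[OF I_powers(2), of n] by (simp add: Ipow_def ideals_set_def)
qed

lemma Ipow_0: "Ipow 0 = carrier R"
proof -
  interpret M: comm_monoid "ideals_set R" by (rule I_powers)
  show ?thesis using M.nat_pow_0[of I] by (simp add: Ipow_def ideals_set_def)
qed

lemma Ipow_1: "Ipow 1 = I"
proof -
  interpret M: comm_monoid "ideals_set R" by (rule I_powers)
  show ?thesis using M.nat_pow_eone[OF I_powers(2)] by (simp only: Ipow_def)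
qed

lemma Ipow_mult: "x \<in> Ipow m \<Longrightarrow> y \<in> Ipow n \<Longrightarrow> x \<otimes> y \<in> Ipow (m + n)"
proof -
  interpret M: comm_monoid "ideals_set R" by (rule I_powers)
  assume "x \<in> Ipow m" "y \<in> Ipow n"
  then have "x \<otimes> y \<in> ideal_prod R (Ipow m) (Ipow n)" by (rule ideal_prod.prod)
  also have "ideal_prod R (Ipow m) (Ipow n) = Ipow (m + n)"
    using M.nat_pow_mult[OF I_powers(2), of m n] by (simp add: Ipow_def ideals_set_def)
  finally show ?thesis .
qed

lemma Ipow_Suc_subset: "Ipow (Suc n) \<subseteq> Ipow n"
proof -
  interpret M: comm_monoid "ideals_set R" by (rule I_powers)
  have "Ipow (Suc n) = ideal_prod R (Ipow n) I"
    unfolding Ipow_def M.nat_pow_Suc by (simp add: ideals_set_def)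
  then show ?thesis using ideal_prod_inter[OF Ipow_ideal[of n] I] by blast
qed

lemma Ipow_carrier: "x \<in> Ipow n \<Longrightarrow> x \<in> carrier R"
  by (rule ideal_carrier[OF Ipow_ideal])

lemma mem_rees: "p \<in> carrier A \<longleftrightarrow> p \<in> carrier P \<and> (\<forall>n. cf p n \<in> Ipow n)"
  by (simp add: rees_algebra_def Ipow_def)

lemma rees_simps:
  "x \<otimes>\<^bsub>A\<^esub> y = x \<otimes>\<^bsub>P\<^esub> y" "x \<oplus>\<^bsub>A\<^esub> y = x \<oplus>\<^bsub>P\<^esub> y" "\<one>\<^bsub>A\<^esub> = \<one>\<^bsub>P\<^esub>" "\<zero>\<^bsub>A\<^esub> = \<zero>\<^bsub>P\<^esub>"
  by (simp_all add: rees_algebra_def)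

lemma Ipow_zero_closed: "\<zero> \<in> Ipow n"
  by (rule ideal_zero[OF Ipow_ideal])

lemma monom_rees: "c \<in> Ipow n \<Longrightarrow> monom P c n \<in> carrier A"
  using Ipow_carrier Ipow_zero_closed by (auto simp: mem_rees)

lemma rees_add: "p \<in> carrier A \<Longrightarrow> q \<in> carrier A \<Longrightarrow> p \<oplus>\<^bsub>P\<^esub> q \<in> carrier A"
  using ideal_add[OF Ipow_ideal] by (auto simp: mem_rees)

lemma rees_neg:
  assumes "p \<in> carrier A"
  shows "\<ominus>\<^bsub>P\<^esub> p \<in> carrier A"
proof -
  have "\<ominus> cf p n \<in> Ipow n" for n
    using ideal_diff[OF Ipow_ideal Ipow_zero_closed, of "cf p n"] assms Ipow_carrier
    by (auto simp: mem_rees a_minus_def)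
  then show ?thesis using assms by (auto simp: mem_rees)
qed

lemma rees_mult:
  assumes "p \<in> carrier A" "q \<in> carrier A"
  shows "p \<otimes>\<^bsub>P\<^esub> q \<in> carrier A"
proof -
  have pq: "p \<in> carrier P" "q \<in> carrier P" using assms by (auto simp: mem_rees)
  have "cf (p \<otimes>\<^bsub>P\<^esub> q) n \<in> Ipow n" for n
    unfolding UP.coeff_mult[OF pq]
  proof (rule ideal_finsum_atMost[OF Ipow_ideal])
    fix i assume i: "i \<le> n"
    have "cf p i \<in> Ipow i" "cf q (n - i) \<in> Ipow (n - i)" using assms by (auto simp: mem_rees)
    then show "cf p i \<otimes> cf q (n - i) \<in> Ipow n" using Ipow_mult[of "cf p i" i _ "n - i"] i by simp
  qed
  then show ?thesis using pq by (simp add: mem_rees)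
qed

lemma rees_cring: "cring A"
proof -
  have "subcring (carrier A) P"
  proof (rule UP.P.subcringI', rule UP.P.subringI)
    show "carrier A \<subseteq> carrier P" by (auto simp: mem_rees)
    show "\<one>\<^bsub>P\<^esub> \<in> carrier A"
      using Ipow_0 Ipow_zero_closed by (auto simp: mem_rees)
  qed (rule rees_neg rees_add rees_mult; assumption)+
  then have "cring (P\<lparr>carrier := carrier A\<rparr>)"
    using UP.P.subcring_iff[of "carrier A"] by (simp add: subset_iff mem_rees)
  then show ?thesis by (simp add: rees_algebra_def)
qed

definition "J = PIdl\<^bsub>UP R\<^esub> f \<inter> carrier A"

lemma rees_quotient_J: "rees_quotient R I a b = A Quot J"
  by (simp add: rees_quotient_def J_def)

lemma f_closed: "f \<in> carrier P"
  using a b by (simp add: quadratic_poly_def)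

lemma J_ideal: "ideal J A"
proof (rule cring.idealI_cring[OF rees_cring])
  note id = UP.P.cgenideal_ideal[OF f_closed]
  show "J \<subseteq> carrier A" by (simp add: J_def)
  show "\<zero>\<^bsub>A\<^esub> \<in> J"
    using UP.P.ideal_zero[OF id] Ipow_zero_closed by (simp add: J_def rees_simps mem_rees)
  show "x \<oplus>\<^bsub>A\<^esub> y \<in> J" if "x \<in> J" "y \<in> J" for x y
    using that UP.P.ideal_add[OF id] rees_add by (simp add: J_def rees_simps)
  show "r \<otimes>\<^bsub>A\<^esub> x \<in> J" if "r \<in> carrier A" "x \<in> J" for r x
    using that UP.P.ideal_mult[OF id] rees_mult by (simp add: J_def rees_simps mem_rees)
qed

lemma monom_mult_f:
  assumes [simp]: "c \<in> carrier R"
  shows "monom P c n \<otimes>\<^bsub>P\<^esub> f =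
    monom P c (n + 2) \<oplus>\<^bsub>P\<^esub> (monom P (c \<otimes> a) (n + 1) \<oplus>\<^bsub>P\<^esub> monom P (c \<otimes> b) n)"
proof -
  note [simp] = a b
  have "monom P c n \<otimes>\<^bsub>P\<^esub> f = (monom P c n \<otimes>\<^bsub>P\<^esub> monom P \<one> 2 \<oplus>\<^bsub>P\<^esub> monom P c n \<otimes>\<^bsub>P\<^esub> monom P a 1) \<oplus>\<^bsub>P\<^esub>
      monom P c n \<otimes>\<^bsub>P\<^esub> monom P b 0"
    unfolding quadratic_poly_def by (simp add: UP.P.r_distr del: UP.monom_mult)
  also have "\<dots> = (monom P (c \<otimes> \<one>) (n + 2) \<oplus>\<^bsub>P\<^esub> monom P (c \<otimes> a) (n + 1)) \<oplus>\<^bsub>P\<^esub> monom P (c \<otimes> b) (n + 0)"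
    by (simp only: UP.monom_mult one_closed a b assms)
  also have "\<dots> = monom P c (n + 2) \<oplus>\<^bsub>P\<^esub> (monom P (c \<otimes> a) (n + 1) \<oplus>\<^bsub>P\<^esub> monom P (c \<otimes> b) n)"
    by (simp add: UP.P.a_assoc del: UP.monom_mult)
  finally show ?thesis .
qed

text \<open>These multiples of \<open>f = t\<^sup>2 + a t + b\<close> reduce the degree of elements of the Rees algebra without leaving it, since
\<open>I\<^sup>n\<^sup>+\<^sup>2 \<subseteq> I\<^sup>n\<^sup>+\<^sup>1 \<subseteq> I\<^sup>n\<close>.\<close>

lemma monom_mult_f_in_J:
  assumes c: "c \<in> Ipow (n + 2)"
  shows "monom P c n \<otimes>\<^bsub>P\<^esub> f \<in> J"
proof -
  have cc: "c \<in> carrier R" using Ipow_carrier c .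
  have c1: "c \<in> Ipow (n + 1)" "c \<in> Ipow n"
    using c Ipow_Suc_subset[of "n + 1"] Ipow_Suc_subset[of n] by (auto simp: numeral_2_eq_2)
  have "monom P c n \<otimes>\<^bsub>P\<^esub> f \<in> carrier A"
    unfolding monom_mult_f[OF cc]
    using c c1 ideal_mult_right[OF Ipow_ideal] a b by (intro rees_add monom_rees) auto
  moreover have "monom P c n \<otimes>\<^bsub>P\<^esub> f \<in> PIdl\<^bsub>P\<^esub> f"
    using UP.P.ideal_mult[OF UP.P.cgenideal_ideal[OF f_closed] _ UP.P.cgenideal_self[OF f_closed]] cc
    by simp
  ultimately show ?thesis by (simp add: J_def)
qed

lemma f_multiple_coeff:
  assumes g: "g \<in> carrier P"
  shows "cf (g \<otimes>\<^bsub>P\<^esub> f) (n + 2) = (cf g n \<oplus> a \<otimes> cf g (n + 1)) \<oplus> b \<otimes> cf g (n + 2)"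
proof -
  note [simp] = a b g
  have "g \<otimes>\<^bsub>P\<^esub> f = (monom P \<one> 2 \<otimes>\<^bsub>P\<^esub> g \<oplus>\<^bsub>P\<^esub> monom P a 1 \<otimes>\<^bsub>P\<^esub> g) \<oplus>\<^bsub>P\<^esub> monom P b 0 \<otimes>\<^bsub>P\<^esub> g"
    unfolding quadratic_poly_def by (simp add: UP.P.r_distr UP.P.m_comm)
  then have "cf (g \<otimes>\<^bsub>P\<^esub> f) (n + 2) =
    (cf (monom P \<one> 2 \<otimes>\<^bsub>P\<^esub> g) (n + 2) \<oplus> cf (monom P a 1 \<otimes>\<^bsub>P\<^esub> g) (n + 2)) \<oplus> cf (monom P b 0 \<otimes>\<^bsub>P\<^esub> g) (n + 2)"
    by (simp del: UP.coeff_mult)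
  moreover have "cf (monom P \<one> 2 \<otimes>\<^bsub>P\<^esub> g) (n + 2) = \<one> \<otimes> cf g n"
    by (rule UP.coeff_monom_mult) simp_all
  moreover have "cf (monom P a 1 \<otimes>\<^bsub>P\<^esub> g) (n + 2) = a \<otimes> cf g (n + 1)"
    using UP.coeff_monom_mult[OF a g, of 1 "n + 1"] by (simp add: numeral_2_eq_2)
  moreover have "cf (monom P b 0 \<otimes>\<^bsub>P\<^esub> g) (n + 2) = b \<otimes> cf g (n + 2)"
    using UP.coeff_monom_mult[OF b g, of 0 "n + 2"] by simp
  ultimately show ?thesis by (simp del: UP.coeff_mult)
qed

text \<open>As \<open>f\<close> is monic, a nonzero multiple of it has degree at least two.\<close>

lemma linear_in_J_imp_zero:
  assumes r: "r \<in> carrier R" and i: "i \<in> I" and J: "monom P r 0 \<oplus>\<^bsub>P\<^esub> monom P i 1 \<in> J"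
  shows "r = \<zero> \<and> i = \<zero>"
proof -
  have ic [simp]: "i \<in> carrier R" by (rule ideal_carrier[OF I i])
  note [simp] = r
  let ?p = "monom P r 0 \<oplus>\<^bsub>P\<^esub> monom P i 1"
  obtain g where g: "g \<in> carrier P" "?p = g \<otimes>\<^bsub>P\<^esub> f"
    using J by (auto simp: J_def cgenideal_def)
  have "g = \<zero>\<^bsub>P\<^esub>"
  proof (rule ccontr)
    assume "g \<noteq> \<zero>\<^bsub>P\<^esub>"
    then have lc: "cf g (deg R g) \<noteq> \<zero>" using UP.lcoeff_nonzero2[OF g(1)] by simp
    have "cf ?p (deg R g + 2) = cf g (deg R g)"
      unfolding g(2) f_multiple_coeff[OF g(1)] using a b g(1) by (simp add: UP.deg_aboveD)
    moreover have "cf ?p (deg R g + 2) = \<zero>" by simp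
    ultimately show False using lc by simp
  qed
  then have p: "?p = \<zero>\<^bsub>P\<^esub>" using g(2) f_closed by simp
  have "cf ?p 0 = r" "cf ?p 1 = i" by simp_all
  then show ?thesis unfolding p by simp
qed

text \<open>Division by the monic polynomial \<open>f\<close>, carried out inside the Rees algebra.\<close>

lemma linear_remainder:
  assumes "p \<in> carrier A" "\<And>m. m > n + 1 \<Longrightarrow> cf p m = \<zero>"
  shows "\<exists>j\<in>J. \<exists>r\<in>carrier R. \<exists>i\<in>I. p = j \<oplus>\<^bsub>P\<^esub> (monom P r 0 \<oplus>\<^bsub>P\<^esub> monom P i 1)"
  using assms
proof (induction n arbitrary: p)
  case 0
  have pP: "p \<in> carrier P" using 0 by (simp add: mem_rees)
  have "cf p 1 \<in> I" using 0(1) Ipow_1 mem_rees by metis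
  moreover have "p = \<zero>\<^bsub>P\<^esub> \<oplus>\<^bsub>P\<^esub> (monom P (cf p 0) 0 \<oplus>\<^bsub>P\<^esub> monom P (cf p 1) 1)"
  proof (rule UP.up_eqI)
    fix m :: nat
    consider "m = 0" | "m = 1" | "m > 1" by linarith
    then show "cf p m = cf (\<zero>\<^bsub>P\<^esub> \<oplus>\<^bsub>P\<^esub> (monom P (cf p 0) 0 \<oplus>\<^bsub>P\<^esub> monom P (cf p 1) 1)) m"
      using pP 0(2)[of m] by cases auto
  qed (use pP in simp_all)
  moreover have "\<zero>\<^bsub>P\<^esub> \<in> J"
    using cring.ideal_zero[OF rees_cring J_ideal] by (simp add: rees_simps)
  ultimately show ?case using pP UP.coeff_closed by blast
next
  case (Suc n)
  define c where "c = cf p (n + 2)"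
  let ?g = "monom P c n \<otimes>\<^bsub>P\<^esub> f"
  have pP: "p \<in> carrier P" using Suc.prems by (simp add: mem_rees)
  have c: "c \<in> Ipow (n + 2)" using Suc.prems(1) by (simp add: c_def mem_rees)
  have cc [simp]: "c \<in> carrier R" using pP by (simp add: c_def)
  have gJ: "?g \<in> J" by (rule monom_mult_f_in_J[OF c])
  then have gA: "?g \<in> carrier A" by (simp add: J_def)
  then have gP: "?g \<in> carrier P" by (simp add: mem_rees)
  let ?p = "p \<oplus>\<^bsub>P\<^esub> \<ominus>\<^bsub>P\<^esub> ?g"
  have pA: "?p \<in> carrier A" using Suc.prems(1) gA rees_add rees_neg by blast
  have "cf ?p m = \<zero>" if m: "m > n + 1" for m
  proof -
    have "cf ?g m = cf p m"
    proof (cases "m = n + 2")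
      case True
      then have cm: "cf p m = c" by (simp add: c_def)
      show ?thesis unfolding monom_mult_f[OF cc] cm using a b True by (simp del: UP.coeff_mult)
    next
      case False
      then show ?thesis unfolding monom_mult_f[OF cc] using a b m Suc.prems(2)[of m]
        by (simp del: UP.coeff_mult)
    qed
    moreover have "cf ?p m = cf p m \<oplus> \<ominus> cf ?g m"
      using pP gP by (simp del: UP.coeff_mult)
    ultimately show ?thesis using pP by (simp add: r_neg)
  qed
  then obtain j r i where j: "j \<in> J" "r \<in> carrier R" "i \<in> I"
    and p: "?p = j \<oplus>\<^bsub>P\<^esub> (monom P r 0 \<oplus>\<^bsub>P\<^esub> monom P i 1)"
    using Suc.IH[OF pA] by blast
  have ic: "i \<in> carrier R" by (rule ideal_carrier[OF I j(3)])
  have jP: "j \<in> carrier P" using j by (simp add: J_def mem_rees)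
  let ?l = "monom P r 0 \<oplus>\<^bsub>P\<^esub> monom P i 1"
  have lP: "?l \<in> carrier P" using j ic by simp
  have "p = ?g \<oplus>\<^bsub>P\<^esub> ?p"
    using UP.P.r_neg2[of p] pP gP UP.P.a_lcomm[OF gP pP] UP.P.r_neg[OF gP] by simp
  also have "\<dots> = (?g \<oplus>\<^bsub>P\<^esub> j) \<oplus>\<^bsub>P\<^esub> ?l"
    unfolding p using UP.P.a_assoc[OF gP jP lP] by simp
  finally have "p = (?g \<oplus>\<^bsub>P\<^esub> j) \<oplus>\<^bsub>P\<^esub> ?l" .
  moreover have "?g \<oplus>\<^bsub>P\<^esub> j \<in> J"
    using cring.ideal_add[OF rees_cring J_ideal gJ j(1)] by (simp add: rees_simps)
  ultimately show ?case using j by blast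
qed

text \<open>The multiplication rule for \<open>\<psi>\<close> comes from \<open>(i t) (j t) = i j f - a i j t - b i j\<close>.\<close>

lemma quadratic_extension_rees_quotient:
  assumes loc: "noetherian_local R \<mm>" and I\<mm>: "I \<subseteq> \<mm>"
  shows "quadratic_extension R \<mm> (rees_quotient R I a b) I a b
    (\<lambda>r. J +>\<^bsub>A\<^esub> monom P r 0) (\<lambda>i. J +>\<^bsub>A\<^esub> monom P i 1)"
proof -
  interpret A: cring A by (rule rees_cring)
  interpret J: ideal J A by (rule J_ideal)
  let ?S = "A Quot J"
  let ?q = "\<lambda>p. J +>\<^bsub>A\<^esub> p"
  interpret q: ring_hom_cring A ?S ?q by (rule J.rcos_ring_hom_cring[OF rees_cring])
  have q_add: "?q (x \<oplus>\<^bsub>P\<^esub> y) = ?q x \<oplus>\<^bsub>?S\<^esub> ?q y" if "x \<in> carrier A" "y \<in> carrier A" for x y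
    using q.hom_add[OF that] by (simp add: rees_simps)
  have q_mult: "?q (x \<otimes>\<^bsub>P\<^esub> y) = ?q x \<otimes>\<^bsub>?S\<^esub> ?q y" if "x \<in> carrier A" "y \<in> carrier A" for x y
    using q.hom_mult[OF that] by (simp add: rees_simps)
  have zero: "\<zero>\<^bsub>?S\<^esub> = J" unfolding FactRing_def by (rule ring.simps(1))
  have q_J: "?q j = \<zero>\<^bsub>?S\<^esub>" if "j \<in> J" for j
    unfolding zero by (rule A.a_rcos_zero[OF J_ideal that])
  have m0: "monom P r 0 \<in> carrier A" if "r \<in> carrier R" for r
    using that by (intro monom_rees) (simp add: Ipow_0)
  have m1: "monom P i 1 \<in> carrier A" if "i \<in> I" for i
    using that by (intro monom_rees) (simp only: Ipow_1)
  have Ic: "i \<in> carrier R" if "i \<in> I" for i by (rule ideal_carrier[OF I that])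
  have JA: "j \<in> carrier A" if "j \<in> J" for j using that by (simp add: J_def)
  show ?thesis
    unfolding rees_quotient_J
  proof (intro quadratic_extension.intro quadratic_extension_axioms.intro loc I I\<mm> a b)
    show "cring ?S" by (rule q.S.is_cring)
    show "(\<lambda>r. ?q (monom P r 0)) \<in> ring_hom R ?S"
    proof (rule ring_hom_memI)
      show "?q (monom P r 0) \<in> carrier ?S" if "r \<in> carrier R" for r
        using m0[OF that] by simp
      show "?q (monom P (r \<otimes> s) 0) = ?q (monom P r 0) \<otimes>\<^bsub>?S\<^esub> ?q (monom P s 0)"
        if "r \<in> carrier R" "s \<in> carrier R" for r s
        using q_mult[OF m0 m0] that UP.monom_mult[of r s 0 0] by simp
      show "?q (monom P (r \<oplus> s) 0) = ?q (monom P r 0) \<oplus>\<^bsub>?S\<^esub> ?q (monom P s 0)"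
        if "r \<in> carrier R" "s \<in> carrier R" for r s
        using q_add[OF m0 m0] that by simp
      show "?q (monom P \<one> 0) = \<one>\<^bsub>?S\<^esub>"
        using q.hom_one by (simp add: rees_simps)
    qed
    show "?q (monom P i 1) \<in> carrier ?S" if "i \<in> I" for i using m1[OF that] by simp
    show "?q (monom P (i \<oplus> j) 1) = ?q (monom P i 1) \<oplus>\<^bsub>?S\<^esub> ?q (monom P j 1)" if "i \<in> I" "j \<in> I" for i j
      using q_add[OF m1 m1] that Ic by simp
    show "?q (monom P r 0) \<otimes>\<^bsub>?S\<^esub> ?q (monom P i 1) = ?q (monom P (r \<otimes> i) 1)"
      if "r \<in> carrier R" "i \<in> I" for r i
      using q_mult[OF m0 m1] that Ic UP.monom_mult[of r i 0 1] by simp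
    show "?q (monom P i 1) \<otimes>\<^bsub>?S\<^esub> ?q (monom P j 1) =
        ?q (monom P (\<ominus> (b \<otimes> (i \<otimes> j))) 0) \<oplus>\<^bsub>?S\<^esub> ?q (monom P (\<ominus> (a \<otimes> (i \<otimes> j))) 1)"
      if i: "i \<in> I" and j: "j \<in> I" for i j
    proof -
      let ?c = "i \<otimes> j"
      have cI: "?c \<in> I" using ideal_mult[OF I Ic[OF i] j] .
      have c: "?c \<in> Ipow (0 + 2)" using Ipow_mult[of i 1 j 1] i j Ipow_1 by (simp add: numeral_2_eq_2)
      have cc: "?c \<in> carrier R" using Ic cI by blast
      let ?r = "monom P (\<ominus> (b \<otimes> ?c)) 0 \<oplus>\<^bsub>P\<^esub> monom P (\<ominus> (a \<otimes> ?c)) 1"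
      have nI: "\<ominus> (a \<otimes> ?c) \<in> I"
        using ideal_diff[OF I ideal_zero[OF I] ideal_mult[OF I a cI]] a cc by (simp add: a_minus_def)
      have rA: "monom P (\<ominus> (b \<otimes> ?c)) 0 \<in> carrier A" "monom P (\<ominus> (a \<otimes> ?c)) 1 \<in> carrier A"
        using m0[OF a_inv_closed[OF m_closed[OF b cc]]] m1[OF nI] by blast+
      have "monom P i 1 \<otimes>\<^bsub>P\<^esub> monom P j 1 = monom P ?c (0 + 2)"
        using UP.monom_mult[of i j 1 1] Ic i j by (simp add: numeral_2_eq_2)
      also have "\<dots> = monom P ?c 0 \<otimes>\<^bsub>P\<^esub> f \<oplus>\<^bsub>P\<^esub> ?r"
        unfolding monom_mult_f[OF cc]
        by (rule UP.up_eqI) (use a b cc in \<open>auto simp: r_neg m_comm simp del: UP.coeff_mult UP.monom_mult\<close>)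
      finally have "?q (monom P i 1) \<otimes>\<^bsub>?S\<^esub> ?q (monom P j 1) = ?q (monom P ?c 0 \<otimes>\<^bsub>P\<^esub> f \<oplus>\<^bsub>P\<^esub> ?r)"
        using q_mult[OF m1[OF i] m1[OF j]] by simp
      also have "\<dots> = \<zero>\<^bsub>?S\<^esub> \<oplus>\<^bsub>?S\<^esub> ?q ?r"
        using q_add[OF JA rees_add[OF rA]] q_J monom_mult_f_in_J[OF c] by simp
      also have "\<dots> = ?q ?r" using rees_add[OF rA] by simp
      finally show ?thesis using q_add[OF rA] by simp
    qed
    show "\<exists>r\<in>carrier R. \<exists>i\<in>I. s = ?q (monom P r 0) \<oplus>\<^bsub>?S\<^esub> ?q (monom P i 1)" if s: "s \<in> carrier ?S" for s
    proof -
      obtain p where p: "p \<in> carrier A" "s = ?q p" using s unfolding FactRing_def A_RCOSETS_def' by auto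
      have pP: "p \<in> carrier P" using p(1) by (simp add: mem_rees)
      obtain j r i where j: "j \<in> J" "r \<in> carrier R" "i \<in> I"
        and eq: "p = j \<oplus>\<^bsub>P\<^esub> (monom P r 0 \<oplus>\<^bsub>P\<^esub> monom P i 1)"
        using linear_remainder[OF p(1), of "deg R p"] UP.deg_aboveD[OF _ pP] by fastforce
      note mA = m0[OF j(2)] m1[OF j(3)]
      have "s = \<zero>\<^bsub>?S\<^esub> \<oplus>\<^bsub>?S\<^esub> (?q (monom P r 0) \<oplus>\<^bsub>?S\<^esub> ?q (monom P i 1))"
        unfolding p(2) eq using q_add[OF JA[OF j(1)] rees_add[OF mA]] q_add[OF mA] q_J[OF j(1)] by simp
      then have "s = ?q (monom P r 0) \<oplus>\<^bsub>?S\<^esub> ?q (monom P i 1)" using mA by simp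
      then show ?thesis using j by blast
    qed
    show "r = \<zero> \<and> i = \<zero>"
      if r: "r \<in> carrier R" and i: "i \<in> I" and eq: "?q (monom P r 0) \<oplus>\<^bsub>?S\<^esub> ?q (monom P i 1) = \<zero>\<^bsub>?S\<^esub>" for r i
    proof -
      note mA = m0[OF r] m1[OF i]
      have "?q (monom P r 0 \<oplus>\<^bsub>P\<^esub> monom P i 1) = J" using q_add[OF mA] eq zero by simp
      then have "monom P r 0 \<oplus>\<^bsub>P\<^esub> monom P i 1 \<in> J"
        by (rule J.rcos_const_imp_mem[OF rees_add[OF mA]])
      then show ?thesis by (rule linear_in_J_imp_zero[OF r i])
    qed
  qed
qed

end

theorem proposition2p7:
  fixes R :: "('a, 'm) ring_scheme" and I :: "'a set" and a b :: 'a and d :: nat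
  assumes "cohen_macaulay_local_ring R"
    and "krull_dim R = enat d"
    and "ideal I R" and "I \<noteq> carrier R"
    and "a \<in> carrier R" and "b \<in> carrier R"
  shows "(I \<noteq> {\<zero>\<^bsub>R\<^esub>} \<longrightarrow>
           (cohen_macaulay_local_ring (rees_quotient R I a b) \<longleftrightarrow>
            cohen_macaulay_module R (ideal_module R I) \<and> module_dim R (ideal_module R I) = enat d)) \<and>
         (\<forall>a' \<in> carrier R. \<forall>b' \<in> carrier R.
           cohen_macaulay_local_ring (rees_quotient R I a b) \<longleftrightarrow>
           cohen_macaulay_local_ring (rees_quotient R I a' b'))"
proof -
  have loc: "local_ring R" "noetherian_ring R"
    using assms(1) by (auto simp: cohen_macaulay_local_ring_def)
  interpret noetherian_local R "max_ideal R" by (rule noetherian_localI[OF loc])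
  have "\<one>\<^bsub>R\<^esub> \<notin> I" using assms(4) ideal.one_imp_carrier[OF assms(3)] by blast
  then have Im: "I \<subseteq> max_ideal R" by (rule proper_ideal_subset[OF assms(3)])
  let ?reg = "\<exists>zs. length zs = d \<and> set zs \<subseteq> max_ideal R \<and> weakly_regular R I {\<zero>\<^bsub>R\<^esub>} zs"
  have CM: "cohen_macaulay_local_ring (rees_quotient R I x y) \<longleftrightarrow> ?reg"
    if "x \<in> carrier R" "y \<in> carrier R" for x y
  proof -
    interpret rees_setup R I x y
      by (intro rees_setup.intro rees_setup_axioms.intro is_cring assms(3) that)
    interpret Q: quadratic_extension R "max_ideal R" "rees_quotient R I x y" I x y
      "\<lambda>r. J +>\<^bsub>A\<^esub> monom P r 0" "\<lambda>i. J +>\<^bsub>A\<^esub> monom P i 1"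
      by (rule quadratic_extension_rees_quotient[OF noetherian_local_axioms Im])
    show ?thesis by (rule Q.cohen_macaulay_S_iff[OF assms(1,2)])
  qed
  have "?reg \<longleftrightarrow> cohen_macaulay_module R (ideal_module R I) \<and> module_dim R (ideal_module R I) = enat d"
    if nz: "I \<noteq> {\<zero>\<^bsub>R\<^esub>}"
  proof -
    let ?M = "ideal_module R I"
    have dims: "depth R ?M \<le> module_dim R ?M" "module_dim R ?M \<le> enat d"
      using depth_le_module_dim[OF assms(3)] depth_le_krull_dim(1)[OF assms(3)] assms(2) by auto
    have "?reg \<longleftrightarrow> enat d \<le> depth R ?M" by (rule depth_ge_iff[OF assms(3) nz, symmetric])
    also have "\<dots> \<longleftrightarrow> depth R ?M = module_dim R ?M \<and> module_dim R ?M = enat d"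
      using dims by auto
    also have "\<dots> \<longleftrightarrow> cohen_macaulay_module R ?M \<and> module_dim R ?M = enat d"
      using loc module_ideal_module[OF assms(3)] finitely_generated_ideal_module[OF assms(3)] nz
      by (auto simp: cohen_macaulay_module_def self_module_def)
    finally show ?thesis .
  qed
  then show ?thesis using CM assms(5,6) by blast
qed

end
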